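(* Let $G$ be a connected graph. Then: (i) $G$ is a $2$-cactus if and only if each block of $G$ is either an edge, a cycle, or a $\theta_3$-graph. (ii) $G$ is a $3$-cactus if and only if each block of $G$ is either an edge, a cycle, or a $\theta_t$-graph with $3\le t\le 4$. (iii) $G$ is a $4$-cactus if and only if each block of $G$ is either an edge, a cycle, a $\theta_3'$-graph, or a $\theta_t$-graph with $3\le t\le 5$.
   Context: All graphs are finite and simple. For an integer $k\ge 1$, a $k$-cactus is a connected graph in which every edge is contained in at most $k$ cycles. A block of a graph is a maximal connected subgraph without a cut-vertex. For $t\ge 3$, the graph $\theta(l_1,\dots,l_t)$ is the union of $t$ internally vertex-disjoint paths of lengths $l_1,\dots,l_t$ (each $\ge 1$, at most one equal to $1$) having the same two end-vertices; a $\theta_t$-graph is any graph of the form $\theta(l_1,\dots,l_t)$. For a subgraph $F$ of a graph $H$, an ear of $F$ (in $H$) is a path in $H$ of length at least $1$ whose two (distinct) end-vertices lie in $F$ and whose internal vertices and edges do not lie in $F$. A $\theta_3'$-graph is a graph $\theta(p,q,r)\cup Q$, where $Q$ is an ear of $\theta(p,q,r)$ whose two end-vertices are not both the two degree-$3$ vertices of $\theta(p,q,r)$.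
   Formalization: The graph G is assumed to have at least two vertices: for a single vertex the statement fails, since it is vacuously a k-cactus while its only block is the vertex itself, which is none of the listed graphs. *)

theory Defs
  imports Main
begin

type_synonym 'a ugraph = "'a set \<times> 'a set set"

abbreviation verts :: "'a ugraph \<Rightarrow> 'a set" where "verts \<equiv> fst"
abbreviation edges :: "'a ugraph \<Rightarrow> 'a set set" where "edges \<equiv> snd"

definition simple_graph :: "'a ugraph \<Rightarrow> bool" where
  "simple_graph G \<longleftrightarrow> finite (verts G) \<and> (\<forall>e\<in>edges G. e \<subseteq> verts G \<and> card e = 2)"

definition subgraph :: "'a ugraph \<Rightarrow> 'a ugraph \<Rightarrow> bool" where
  "subgraph H G \<longleftrightarrow> simple_graph H \<and> verts H \<subseteq> verts G \<and> edges H \<subseteq> edges G"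

definition graph_union :: "'a ugraph \<Rightarrow> 'a ugraph \<Rightarrow> 'a ugraph" where
  "graph_union G H = (verts G \<union> verts H, edges G \<union> edges H)"

definition degree :: "'a ugraph \<Rightarrow> 'a \<Rightarrow> nat" where
  "degree G v = card {e \<in> edges G. v \<in> e}"

text \<open>
  A path is given by the list of its vertices in order; its length (number of edges) is one less
  than the length of the list.
\<close>

definition path_of :: "'a list \<Rightarrow> 'a ugraph" where
  "path_of xs = (set xs, {{xs ! i, xs ! Suc i} | i. Suc i < length xs})"

definition path_in :: "'a ugraph \<Rightarrow> 'a list \<Rightarrow> bool" where
  "path_in G xs \<longleftrightarrow> xs \<noteq> [] \<and> distinct xs \<and> subgraph (path_of xs) G"

definition joined :: "'a ugraph \<Rightarrow> 'a \<Rightarrow> 'a \<Rightarrow> bool" where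
  "joined G u v \<longleftrightarrow> (\<exists>xs. path_in G xs \<and> hd xs = u \<and> last xs = v)"

definition connected_graph :: "'a ugraph \<Rightarrow> bool" where
  "connected_graph G \<longleftrightarrow>
     simple_graph G \<and> verts G \<noteq> {} \<and> (\<forall>u\<in>verts G. \<forall>v\<in>verts G. joined G u v)"

text \<open>
  Cycles are graphs rather than closed walks, so that counting cycles does not distinguish
  rotations and reversals of the same cycle.
\<close>

definition cycle_graph :: "'a ugraph \<Rightarrow> bool" where
  "cycle_graph C \<longleftrightarrow>
     (\<exists>xs. distinct xs \<and> length xs \<ge> 3 \<and>
           C = (set xs, insert {last xs, hd xs} (edges (path_of xs))))"

definition cactus :: "nat \<Rightarrow> 'a ugraph \<Rightarrow> bool" where
  "cactus k G \<longleftrightarrow>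
     connected_graph G \<and>
     (\<forall>e\<in>edges G. card {C. cycle_graph C \<and> subgraph C G \<and> e \<in> edges C} \<le> k)"

definition del_vertex :: "'a ugraph \<Rightarrow> 'a \<Rightarrow> 'a ugraph" where
  "del_vertex G v = (verts G - {v}, {e \<in> edges G. v \<notin> e})"

text \<open>
  A cut-vertex separates two other vertices of the same component; equivalently, deleting it
  increases the number of components.
\<close>

definition cut_vertex :: "'a ugraph \<Rightarrow> 'a \<Rightarrow> bool" where
  "cut_vertex G v \<longleftrightarrow>
     v \<in> verts G \<and>
     (\<exists>x\<in>verts G - {v}. \<exists>y\<in>verts G - {v}. joined G x y \<and> \<not> joined (del_vertex G v) x y)"

definition block :: "'a ugraph \<Rightarrow> 'a ugraph \<Rightarrow> bool" where
  "block B G \<longleftrightarrow>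
     subgraph B G \<and> connected_graph B \<and> (\<nexists>v. cut_vertex B v) \<and>
     (\<forall>H. subgraph H G \<and> connected_graph H \<and> (\<nexists>v. cut_vertex H v) \<and> subgraph B H \<longrightarrow> H = B)"

definition edge_graph :: "'a ugraph \<Rightarrow> bool" where
  "edge_graph G \<longleftrightarrow> (\<exists>u v. u \<noteq> v \<and> G = ({u, v}, {{u, v}}))"

text \<open>\<open>theta ls G\<close>: the graph \<open>G\<close> has the form $\theta(l_1,\dots,l_t)$ with \<open>ls\<close> the list of the $l_i$.\<close>

definition theta :: "nat list \<Rightarrow> 'a ugraph \<Rightarrow> bool" where
  "theta ls G \<longleftrightarrow>
     length ls \<ge> 3 \<and> (\<forall>l\<in>set ls. l \<ge> 1) \<and> count_list ls 1 \<le> 1 \<and>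
     (\<exists>u v Ps. length Ps = length ls \<and>
        (\<forall>i<length ls. distinct (Ps ! i) \<and> length (Ps ! i) = ls ! i + 1 \<and>
                       hd (Ps ! i) = u \<and> last (Ps ! i) = v) \<and>
        (\<forall>i<length ls. \<forall>j<length ls. i \<noteq> j \<longrightarrow> set (Ps ! i) \<inter> set (Ps ! j) = {u, v}) \<and>
        G = (\<Union>P\<in>set Ps. verts (path_of P), \<Union>P\<in>set Ps. edges (path_of P)))"

definition theta_graph :: "nat \<Rightarrow> 'a ugraph \<Rightarrow> bool" where
  "theta_graph t G \<longleftrightarrow> (\<exists>ls. length ls = t \<and> theta ls G)"

definition ear :: "'a ugraph \<Rightarrow> 'a ugraph \<Rightarrow> 'a list \<Rightarrow> bool" where
  "ear H F Q \<longleftrightarrow>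
     subgraph F H \<and> path_in H Q \<and> length Q \<ge> 2 \<and>
     hd Q \<in> verts F \<and> last Q \<in> verts F \<and>
     (set Q - {hd Q, last Q}) \<inter> verts F = {} \<and> edges (path_of Q) \<inter> edges F = {}"

definition theta3'_graph :: "'a ugraph \<Rightarrow> bool" where
  "theta3'_graph G \<longleftrightarrow>
     (\<exists>F p q r Q. theta [p, q, r] F \<and> ear G F Q \<and>
        \<not> (degree F (hd Q) = 3 \<and> degree F (last Q) = 3) \<and>
        G = graph_union F (path_of Q))"

end

theory Submission
  imports Defs
begin

text \<open>
  Write \<open>c\<^sub>H(e)\<close> for the number of cycles of \<open>H\<close> through the edge \<open>e\<close>. Every cycle lies inside a
  single block, so only the values \<open>c\<^sub>B(e)\<close> for blocks \<open>B\<close> matter.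

  Two edges of a 2-connected graph lie on a common cycle, so \<open>c\<^sub>F(e) < c\<^sub>B(e)\<close> for every proper
  subgraph \<open>F\<close> of a 2-connected graph \<open>B\<close> and every edge \<open>e\<close> of \<open>F\<close>. Now grow \<open>B\<close> from a cycle by
  adding ears. As long as all ears are parallel, we have a \<open>\<theta>\<^sub>t\<close>-graph, in which every edge is on
  exactly \<open>t - 1\<close> cycles, one for each other path. As soon as an ear is attached elsewhere, \<open>B\<close>
  contains a \<open>\<theta>\<^sub>3'\<close>-graph, in which some edge is on four cycles: such a graph is a cycle together
  with two different ears that share an edge, and each ear lies on two cycles. If \<open>B\<close> is larger
  than that, an edge is on five cycles.

  The upper bound 4 for \<open>\<theta>\<^sub>3'\<close>-graphs comes from the cycle space: it has at most \<open>2\<^sup>3\<close> elements, at most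
  half of which contain a given edge.
\<close>

section \<open>Paths as vertex lists\<close>

text \<open>The edge set of \<open>path_of\<close> without list positions, recursive so that later
  proofs can use induction and simplification.\<close>

fun path_edges :: "'a list \<Rightarrow> 'a set set" where
  "path_edges [] = {}"
| "path_edges [x] = {}"
| "path_edges (x # y # zs) = insert {x, y} (path_edges (y # zs))"

lemma edges_path_of: "edges (path_of xs) = path_edges xs"
proof (induction xs rule: path_edges.induct)
  case (3 x y zs)
  \<comment> \<open>Index 0 gives the first edge; the successor indices are the positions of the
    tail.\<close>
  have shift: "(\<exists>i. p i) \<longleftrightarrow> p 0 \<or> (\<exists>i. p (Suc i))" for p :: "nat \<Rightarrow> bool"
    by (metis not0_implies_Suc)
  have "f \<in> edges (path_of (x # y # zs)) \<longleftrightarrow> f = {x, y} \<or> f \<in> edges (path_of (y # zs))" for f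
  proof -
    have "f \<in> edges (path_of (x # y # zs)) \<longleftrightarrow>
        (\<exists>i. Suc i < length (x # y # zs) \<and> f = {(x # y # zs) ! i, (x # y # zs) ! Suc i})"
      unfolding path_of_def snd_conv by blast
    also have "\<dots> \<longleftrightarrow> f = {x, y} \<or>
        (\<exists>i. Suc i < length (y # zs) \<and> f = {(y # zs) ! i, (y # zs) ! Suc i})"
      by (subst shift) simp
    finally show ?thesis unfolding path_of_def snd_conv by blast
  qed
  then have "edges (path_of (x # y # zs)) = insert {x, y} (edges (path_of (y # zs)))" by blast
  also have "edges (path_of (y # zs)) = path_edges (y # zs)" by (fact 3)
  finally show ?case by (simp only: path_edges.simps)
qed (auto simp: path_of_def)

lemma path_of_eq: "path_of xs = (set xs, path_edges xs)"
  unfolding edges_path_of[symmetric] by (simp add: path_of_def)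

lemma path_edges_Cons: "xs \<noteq> [] \<Longrightarrow> path_edges (x # xs) = insert {x, hd xs} (path_edges xs)"
  by (cases xs) auto

lemma path_edges_append:
  "xs \<noteq> [] \<Longrightarrow> ys \<noteq> [] \<Longrightarrow>
    path_edges (xs @ ys) = path_edges xs \<union> path_edges ys \<union> {{last xs, hd ys}}"
  by (induction xs rule: path_edges.induct) (auto simp: path_edges_Cons)

text \<open>Splitting at a vertex, which both halves keep, avoids the connecting edge of
  \<open>path_edges_append\<close>.\<close>

lemma path_edges_join: "path_edges (xs @ x # ys) = path_edges (xs @ [x]) \<union> path_edges (x # ys)"
  by (cases "xs = []"; cases "ys = []") (auto simp: path_edges_append path_edges_Cons)

lemma path_edges_rev [simp]: "path_edges (rev xs) = path_edges xs"
proof (induction xs)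
  case (Cons x xs)
  then show ?case
    by (cases "xs = []") (auto simp: path_edges_append path_edges_Cons last_rev insert_commute)
qed simp

lemma path_edges_subset: "f \<in> path_edges xs \<Longrightarrow> f \<subseteq> set xs"
  by (induction xs rule: path_edges.induct) auto

lemma card_path_edge: "distinct xs \<Longrightarrow> f \<in> path_edges xs \<Longrightarrow> card f = 2"
  by (induction xs rule: path_edges.induct) auto

lemma path_edges_empty_iff: "path_edges xs = {} \<longleftrightarrow> length xs < 2"
  by (induction xs rule: path_edges.induct) auto

lemma path_edges_cover: "length xs \<ge> 2 \<Longrightarrow> \<Union>(path_edges xs) = set xs"
proof (induction xs rule: path_edges.induct)
  case (3 x y zs)
  then show ?case by (cases zs) auto
qed auto

lemma finite_path_edges [simp]: "finite (path_edges xs)"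
  by (induction xs rule: path_edges.induct) auto

lemma hd_edge_unique:
  assumes "distinct xs" and "f \<in> path_edges xs" and "hd xs \<in> f"
  shows "f = {hd xs, hd (tl xs)}"
proof (cases xs rule: path_edges.cases)
  case (3 x y zs)
  have "f \<notin> path_edges (y # zs)"
    using assms(1,3) 3 path_edges_subset[of f "y # zs"] by auto
  then show ?thesis using assms(2) 3 by auto
qed (use assms in auto)

text \<open>The only edge at the first vertex leads to the second one, which must therefore be the
  last. This turns statements about shared vertices into statements about shared edges: a path with
  an edge between its ends is that single edge.\<close>

lemma path_edge_ends:
  assumes "distinct xs" and "f \<in> path_edges xs" and "f \<subseteq> {hd xs, last xs}"
  shows "xs = [hd xs, last xs]"
proof -
  have "card f = 2" using assms card_path_edge by blast
  then have "f = {hd xs, last xs}"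
    using assms(3) card_insert_le_m1[of 2 "{last xs}" "hd xs"] by (intro card_seteq) auto
  then have l: "f = {hd xs, hd (tl xs)}" "hd xs \<noteq> last xs"
    using hd_edge_unique[OF assms(1,2)] \<open>card f = 2\<close> by auto
  with \<open>f = {hd xs, last xs}\<close> have "last xs = hd (tl xs)" by (auto simp: doubleton_eq_iff)
  then show ?thesis
    using assms(1) l(2) by (cases xs; cases "tl xs") (auto split: if_splits)
qed

section \<open>Connectivity\<close>

text \<open>It depends on an edge set alone, so deleting a vertex is just filtering edges. Every
  element of the type reaches itself, which is why \<open>joined_iff\<close> also asks for
  \<open>u\<close> to be a vertex.\<close>

definition reach :: "'a set set \<Rightarrow> ('a \<times> 'a) set" where
  "reach E = {(a, b). {a, b} \<in> E}\<^sup>*"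

lemma reach_refl [simp]: "(a, a) \<in> reach E"
  by (simp add: reach_def)

lemma reach_edge: "{a, b} \<in> E \<Longrightarrow> (a, b) \<in> reach E"
  by (auto simp: reach_def)

lemma reach_trans: "(a, b) \<in> reach E \<Longrightarrow> (b, c) \<in> reach E \<Longrightarrow> (a, c) \<in> reach E"
  unfolding reach_def by (rule rtrancl_trans)

lemma reach_sym: "(a, b) \<in> reach E \<Longrightarrow> (b, a) \<in> reach E"
proof -
  have "sym {(a, b). {a, b} \<in> E}" by (auto simp: sym_def insert_commute)
  then show "(a, b) \<in> reach E \<Longrightarrow> (b, a) \<in> reach E"
    unfolding reach_def using sym_rtrancl symD by metis
qed

lemma reach_mono: "(a, b) \<in> reach E \<Longrightarrow> E \<subseteq> E' \<Longrightarrow> (a, b) \<in> reach E'"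
  unfolding reach_def by (rule rtrancl_mono[THEN subsetD]) auto

lemma reach_path: "x \<in> set xs \<Longrightarrow> (hd xs, x) \<in> reach (path_edges xs)"
proof (induction xs rule: path_edges.induct)
  case (3 y z zs)
  show ?case
  proof (cases "x = y")
    case False
    then have "(z, x) \<in> reach (path_edges (z # zs))" using 3 by auto
    then have "(z, x) \<in> reach (path_edges (y # z # zs))" by (rule reach_mono) auto
    moreover have "(y, z) \<in> reach (path_edges (y # z # zs))" by (rule reach_edge) auto
    ultimately show ?thesis using reach_trans by fastforce
  qed auto
qed auto

lemma reach_in_path: "x \<in> set xs \<Longrightarrow> y \<in> set xs \<Longrightarrow> (x, y) \<in> reach (path_edges xs)"
  using reach_path reach_sym reach_trans by metis

text \<open>The path is built backwards along the walk: if \<open>r\<close> lies in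
  \<open>X\<close>, stop there; if \<open>r\<close> is new, prepend it; if \<open>r\<close> already
  occurs, cut off the part before it.\<close>

lemma reach_first_hit:
  assumes "(r, s) \<in> reach E" and "s \<in> X"
  shows "\<exists>xs. xs \<noteq> [] \<and> distinct xs \<and> hd xs = r \<and> last xs \<in> X \<and> set (butlast xs) \<inter> X = {} \<and>
    path_edges xs \<subseteq> E"
  using assms unfolding reach_def
proof (induction rule: converse_rtrancl_induct)
  case base
  then show ?case by (intro exI[of _ "[s]"]) auto
next
  case (step r r')
  then obtain xs where xs: "xs \<noteq> []" "distinct xs" "hd xs = r'" "last xs \<in> X"
    "set (butlast xs) \<inter> X = {}" "path_edges xs \<subseteq> E" by auto
  consider "r \<in> X" | "r \<notin> X" "r \<notin> set xs" | "r \<in> set xs" by auto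
  then show ?case
  proof cases
    case 1
    then show ?thesis by (intro exI[of _ "[r]"]) auto
  next
    case 2
    then show ?thesis using xs step(1) by (intro exI[of _ "r # xs"]) (auto simp: path_edges_Cons)
  next
    case 3
    then obtain as bs where "xs = as @ r # bs" by (meson split_list)
    then show ?thesis using xs
      by (intro exI[of _ "r # bs"]) (auto simp: path_edges_join[of as r bs] butlast_append split: if_splits)
  qed
qed

section \<open>Joined vertices and 2-connectedness in terms of reachability\<close>

lemma path_in_iff:
  "path_in G xs \<longleftrightarrow> xs \<noteq> [] \<and> distinct xs \<and> set xs \<subseteq> verts G \<and> path_edges xs \<subseteq> edges G"
  unfolding path_in_def subgraph_def simple_graph_def path_of_eq
  by (auto dest: path_edges_subset card_path_edge)

lemma joined_iff:
  assumes "simple_graph G"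
  shows "joined G u v \<longleftrightarrow> u \<in> verts G \<and> (u, v) \<in> reach (edges G)"
proof
  assume "joined G u v"
  then obtain xs where xs: "path_in G xs" "hd xs = u" "last xs = v" by (auto simp: joined_def)
  then have "(u, v) \<in> reach (path_edges xs)" "u \<in> set xs"
    unfolding path_in_iff using reach_path[of "last xs" xs] by auto
  then show "u \<in> verts G \<and> (u, v) \<in> reach (edges G)"
    using xs(1) unfolding path_in_iff by (auto intro: reach_mono)
next
  assume a: "u \<in> verts G \<and> (u, v) \<in> reach (edges G)"
  then obtain xs where xs: "xs \<noteq> []" "distinct xs" "hd xs = u" "last xs = v" "path_edges xs \<subseteq> edges G"
    using reach_first_hit[of u v "edges G" "{v}"] by auto
  \<comment> \<open>A path with an edge has its vertices covered by its edges; otherwise its only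
    vertex is \<open>u\<close>.\<close>
  have "set xs \<subseteq> verts G"
  proof (cases "length xs \<ge> 2")
    case True
    then show ?thesis using path_edges_cover[OF True] xs(5) assms
      unfolding simple_graph_def by blast
  next
    case False
    then obtain x where "xs = [x]" using xs(1) by (cases xs; cases "tl xs") auto
    then show ?thesis using a xs(3) by auto
  qed
  then show "joined G u v" unfolding joined_def path_in_iff using xs by blast
qed

text \<open>The property for which blocks are maximal. One-vertex and one-edge graphs have it too,
  so results that produce cycles ask for three vertices in addition.\<close>

definition biconn :: "'a ugraph \<Rightarrow> bool" where
  "biconn G \<longleftrightarrow> connected_graph G \<and> (\<nexists>v. cut_vertex G v)"

lemma simple_del_vertex: "simple_graph G \<Longrightarrow> simple_graph (del_vertex G v)"
  by (auto simp: simple_graph_def del_vertex_def)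

lemma biconn_iff:
  "biconn G \<longleftrightarrow> simple_graph G \<and> verts G \<noteq> {} \<and>
     (\<forall>u\<in>verts G. \<forall>v\<in>verts G. (u, v) \<in> reach (edges G)) \<and>
     (\<forall>w\<in>verts G. \<forall>u\<in>verts G - {w}. \<forall>v\<in>verts G - {w}. (u, v) \<in> reach {e \<in> edges G. w \<notin> e})"
proof (cases "simple_graph G")
  case True
  have "joined (del_vertex G w) u v \<longleftrightarrow> u \<in> verts G - {w} \<and> (u, v) \<in> reach {e \<in> edges G. w \<notin> e}" for w u v
    using joined_iff[OF simple_del_vertex[OF True]] by (simp add: del_vertex_def)
  then show ?thesis
    unfolding biconn_def connected_graph_def cut_vertex_def using True
    by (simp add: joined_iff[OF True]) blast
qed (auto simp: biconn_def connected_graph_def)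

lemma biconn_avoiding:
  assumes "biconn G" and "u \<in> verts G - {w}" and "v \<in> verts G - {w}"
  shows "(u, v) \<in> reach {e \<in> edges G. w \<notin> e}"
proof (cases "w \<in> verts G")
  case False
  then have "{e \<in> edges G. w \<notin> e} = edges G"
    using assms(1) unfolding biconn_iff simple_graph_def by auto
  then show ?thesis using assms unfolding biconn_iff by auto
qed (use assms in \<open>auto simp: biconn_iff\<close>)

text \<open>Deleting one vertex leaves at least one of the two common vertices, and both parts
  remain connected to it.\<close>

lemma biconn_union:
  assumes A: "biconn A" and B: "biconn B"
    and ab: "a \<in> verts A \<inter> verts B" "b \<in> verts A \<inter> verts B" "a \<noteq> b"
  shows "biconn (graph_union A B)"
proof -
  let ?V = "verts A \<union> verts B" and ?E = "edges A \<union> edges B"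
  have 1: "(u, a) \<in> reach ?E" if "u \<in> ?V" for u
    using that A B ab unfolding biconn_iff by (blast intro: reach_mono)
  have 2: "(u, v) \<in> reach {e \<in> ?E. w \<notin> e}" if "u \<in> ?V - {w}" "v \<in> ?V - {w}" for u v w
  proof -
    obtain z where z: "z \<in> verts A - {w}" "z \<in> verts B - {w}" using ab by blast
    have "(x, z) \<in> reach {e \<in> ?E. w \<notin> e}" if "x \<in> ?V - {w}" for x
    proof (cases "x \<in> verts A")
      case True
      then have "(x, z) \<in> reach {e \<in> edges A. w \<notin> e}" using biconn_avoiding[OF A _ z(1)] that by auto
      then show ?thesis by (rule reach_mono) auto
    next
      case False
      then have "(x, z) \<in> reach {e \<in> edges B. w \<notin> e}" using biconn_avoiding[OF B _ z(2)] that by auto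
      then show ?thesis by (rule reach_mono) auto
    qed
    from this[OF that(1)] this[OF that(2)] show ?thesis by (blast intro: reach_trans reach_sym)
  qed
  have 3: "simple_graph (graph_union A B)"
    using A B unfolding biconn_iff simple_graph_def graph_union_def by auto
  show ?thesis unfolding biconn_iff
    using 3 ab(1)
    by (auto simp: graph_union_def intro!: 2[simplified]) (blast intro: reach_trans reach_sym 1)+
qed

lemma biconn_edge:
  assumes "u \<noteq> v"
  shows "biconn ({u, v}, {{u, v}})"
proof -
  have "(u, v) \<in> reach {{u, v}}" "(v, u) \<in> reach {{u, v}}"
    by (auto intro: reach_edge simp: insert_commute)
  then show ?thesis using assms unfolding biconn_iff simple_graph_def by auto
qed

section \<open>Bundles of internally disjoint paths\<close>

text \<open>A common form for cycles (two paths) and theta graphs (three or more). As the paths form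
  a set, the one-edge path from \<open>u\<close> to \<open>v\<close> occurs at most once, which is
  the condition that at most one length is 1.\<close>

definition path_bundle :: "'a \<Rightarrow> 'a \<Rightarrow> 'a list set \<Rightarrow> bool" where
  "path_bundle u v S \<longleftrightarrow> finite S \<and> u \<noteq> v \<and>
     (\<forall>P\<in>S. P \<noteq> [] \<and> distinct P \<and> hd P = u \<and> last P = v) \<and>
     (\<forall>P\<in>S. \<forall>P'\<in>S. P \<noteq> P' \<longrightarrow> set P \<inter> set P' = {u, v})"

definition bundle_graph :: "'a list set \<Rightarrow> 'a ugraph" where
  "bundle_graph S = (\<Union>P\<in>S. set P, \<Union>P\<in>S. path_edges P)"

text \<open>The part of \<open>ear\<close> that does not mention the surrounding graph; containment
  in that graph is stated separately by \<open>path_in\<close>.\<close>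

definition attached :: "'a ugraph \<Rightarrow> 'a list \<Rightarrow> bool" where
  "attached F Q \<longleftrightarrow> distinct Q \<and> length Q \<ge> 2 \<and> hd Q \<in> verts F \<and> last Q \<in> verts F \<and>
     (set Q - {hd Q, last Q}) \<inter> verts F = {} \<and> path_edges Q \<inter> edges F = {}"

lemma verts_bundle_graph [simp]: "verts (bundle_graph S) = (\<Union>P\<in>S. set P)"
  and edges_bundle_graph [simp]: "edges (bundle_graph S) = (\<Union>P\<in>S. path_edges P)"
  by (auto simp: bundle_graph_def)

lemma bundle_subset: "path_bundle u v S \<Longrightarrow> T \<subseteq> S \<Longrightarrow> path_bundle u v T"
  unfolding path_bundle_def by (meson finite_subset subsetD)

lemma bundle_path:
  assumes "path_bundle u v S" and "P \<in> S"
  shows "distinct P" "hd P = u" "last P = v" "u \<in> set P" "v \<in> set P" "length P \<ge> 2" "u \<noteq> v"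
proof -
  show *: "distinct P" "hd P = u" "last P = v" "u \<noteq> v" "u \<in> set P" "v \<in> set P"
    using assms unfolding path_bundle_def by auto
  show "length P \<ge> 2" using * by (cases P; cases "tl P") auto
qed

lemma bundle_path_shape:
  assumes "path_bundle u v S" and "P \<in> S"
  obtains as where "P = u # as @ [v]"
proof -
  obtain xs where P: "P = u # xs" using bundle_path[OF assms] by (cases P) auto
  with bundle_path[OF assms] have "xs \<noteq> []" by auto
  with P bundle_path(3)[OF assms] have "P = u # butlast xs @ [v]" by auto
  then show thesis by (rule that)
qed

lemma bundle_inter:
  "path_bundle u v S \<Longrightarrow> P \<in> S \<Longrightarrow> P' \<in> S \<Longrightarrow> P \<noteq> P' \<Longrightarrow> set P \<inter> set P' = {u, v}"
  by (simp add: path_bundle_def)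

text \<open>A common edge has both ends in \<open>{u, v}\<close>, so each of the two paths is the
  single edge from \<open>u\<close> to \<open>v\<close>, and they coincide.\<close>

lemma bundle_edges_disjoint:
  assumes "path_bundle u v S" and "P \<in> S" "P' \<in> S" "P \<noteq> P'"
  shows "path_edges P \<inter> path_edges P' = {}"
proof (rule ccontr)
  assume "path_edges P \<inter> path_edges P' \<noteq> {}"
  then obtain f where f: "f \<in> path_edges P" "f \<in> path_edges P'" by auto
  then have "f \<subseteq> {u, v}"
    using bundle_inter[OF assms] path_edges_subset[OF f(1)] path_edges_subset[OF f(2)] by blast
  then show False
    using path_edge_ends[OF _ f(1)] path_edge_ends[OF _ f(2)] bundle_path(1-3)[OF assms(1,2)]
      bundle_path(1-3)[OF assms(1,3)] assms(4) by metis
qed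

lemma simple_bundle_graph: "path_bundle u v S \<Longrightarrow> simple_graph (bundle_graph S)"
  unfolding simple_graph_def path_bundle_def
  by (auto dest: path_edges_subset card_path_edge)

lemma bundle_graph_insert:
  "bundle_graph (insert Q S) = graph_union (bundle_graph S) (path_of Q)"
  by (auto simp: bundle_graph_def graph_union_def path_of_eq)

lemma bundle_insert:
  assumes S: "path_bundle u v S" "S \<noteq> {}" and Q: "attached (bundle_graph S) Q" "hd Q = u" "last Q = v"
  shows "path_bundle u v (insert Q S)" and "Q \<notin> S"
proof -
  have Q': "distinct Q" "Q \<noteq> []" "length Q \<ge> 2" "path_edges Q \<inter> (\<Union>P\<in>S. path_edges P) = {}"
    "(set Q - {u, v}) \<inter> (\<Union>P\<in>S. set P) = {}"
    using Q unfolding attached_def by auto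
  have "path_edges Q \<noteq> {}" using Q'(3) by (simp add: path_edges_empty_iff)
  with Q'(4) show "Q \<notin> S" by blast
  have uv: "u \<in> set Q" "v \<in> set Q" using Q Q'(2) by auto
  have "set Q \<inter> set P = {u, v}" if "P \<in> S" for P
    using that uv Q'(5) bundle_path(4,5)[OF S(1) that] by auto
  then show "path_bundle u v (insert Q S)"
    using S(1) Q Q'(1,2) unfolding path_bundle_def by (auto simp: Int_commute)
qed

lemma attached_rev: "attached F (rev Q) = attached F Q"
  unfolding attached_def by (cases "Q = []") (auto simp: hd_rev last_rev)

section \<open>Cycles\<close>

text \<open>The vertex list is cut in front of \<open>w\<close> and its two pieces are swapped; the
  closing edge becomes an inner edge and the edge into \<open>w\<close> closes the cycle.\<close>

lemma cycle_rotate: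
  assumes "cycle_graph C" and "w \<in> verts C"
  obtains ys where "distinct (w # ys)" "length ys \<ge> 2"
    "C = (set (w # ys), insert {last ys, w} (path_edges (w # ys)))"
proof -
  obtain xs where xs: "distinct xs" "length xs \<ge> 3"
    "C = (set xs, insert {last xs, hd xs} (path_edges xs))"
    using assms(1) unfolding cycle_graph_def edges_path_of by auto
  then obtain as bs where ab: "xs = as @ w # bs" using assms(2) by (metis fst_conv split_list)
  have "distinct (w # bs @ as)" "length (bs @ as) \<ge> 2" using xs ab by auto
  moreover have "insert {last xs, hd xs} (path_edges xs)
    = insert {last (bs @ as), w} (path_edges (w # bs @ as))"
  proof (cases "as = []")
    case True
    then show ?thesis using ab xs(2) by auto
  next
    case False
    have "path_edges xs = path_edges as \<union> path_edges (w # bs) \<union> {{last as, w}}"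
      using ab False by (simp add: path_edges_append)
    moreover have "path_edges ((w # bs) @ as) = path_edges (w # bs) \<union> path_edges as \<union> {{last (w # bs), hd as}}"
      using False by (subst path_edges_append) auto
    moreover have "last xs = last (w # bs)" "hd xs = hd as" "last (bs @ as) = last as"
      using ab False by auto
    ultimately show ?thesis by auto
  qed
  moreover have "set xs = set (w # bs @ as)" using ab by auto
  ultimately show thesis using that[of "bs @ as"] xs(3) by simp
qed

text \<open>After rotation to \<open>q\<close>, the list is cut at \<open>s\<close>; the second arc
  is read backwards so that both arcs run from \<open>q\<close> to \<open>s\<close>.\<close>

lemma cycle_bundle:
  assumes "cycle_graph C" and "q \<in> verts C" "s \<in> verts C" "q \<noteq> s"
  obtains R R' where "R \<noteq> R'" "path_bundle q s {R, R'}" "C = bundle_graph {R, R'}"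
proof -
  obtain ys where ys: "distinct (q # ys)" "length ys \<ge> 2"
    "C = (set (q # ys), insert {last ys, q} (path_edges (q # ys)))"
    using cycle_rotate[OF assms(1,2)] by metis
  then obtain as bs where ab: "ys = as @ s # bs" using assms(3,4) by (auto dest: split_list)
  let ?R = "q # as @ [s]" and ?R' = "q # rev bs @ [s]"
  \<comment> \<open>Equal arcs would have the same inner vertices, but these are disjoint; both arcs
    would be single edges, leaving only two vertices.\<close>
  have "?R \<noteq> ?R'"
  proof
    assume "?R = ?R'"
    then have "as = rev bs" by simp
    then have "set as = set bs" by simp
    then show False using ys(1,2) ab by (cases as; cases bs) auto
  qed
  moreover have "path_bundle q s {?R, ?R'}" using ys(1) ab assms(4) unfolding path_bundle_def by auto
  moreover have "C = bundle_graph {?R, ?R'}"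
  proof -
    have "path_edges ?R' = path_edges (rev ?R')" by (rule path_edges_rev[symmetric])
    also have "\<dots> = path_edges ((s # bs) @ [q])" by simp
    also have "\<dots> = path_edges (s # bs) \<union> {{last (s # bs), q}}" by (subst path_edges_append) auto
    finally have "path_edges ?R' = path_edges (s # bs) \<union> {{last ys, q}}" using ab by simp
    moreover have "path_edges (q # ys) = path_edges ?R \<union> path_edges (s # bs)"
      using path_edges_join[of "q # as" s bs] ab by simp
    moreover have "set (q # ys) = set ?R \<union> set ?R'" using ab by auto
    ultimately show ?thesis using ys(3) by (auto simp: bundle_graph_def)
  qed
  ultimately show thesis by (rule that)
qed

text \<open>The cycle runs along \<open>R\<close> and returns along \<open>R'\<close>
  reversed.\<close>

lemma bundle_cycle:
  assumes "path_bundle u v {R, R'}" and "R \<noteq> R'"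
  shows "cycle_graph (bundle_graph {R, R'})"
proof -
  obtain as where R: "R = u # as @ [v]" using bundle_path_shape[OF assms(1)] by blast
  obtain bs where R': "R' = u # bs @ [v]" using bundle_path_shape[OF assms(1), of R'] by blast
  have "set R \<inter> set R' = {u, v}" using bundle_inter[OF assms(1)] assms(2) by blast
  then have "set as \<inter> set bs = {}"
    using bundle_path(1)[OF assms(1), of R] bundle_path(1)[OF assms(1), of R'] R R' by auto
  let ?xs = "(u # as @ [v]) @ rev bs"
  have d: "distinct ?xs"
    using \<open>set as \<inter> set bs = {}\<close> bundle_path(1)[OF assms(1), of R]
      bundle_path(1)[OF assms(1), of R'] R R' by auto
  \<comment> \<open>Without any inner vertex the two paths would be equal.\<close>
  moreover have "length ?xs \<ge> 3" using assms(2) R R' by (cases as; cases bs) auto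
  moreover have "bundle_graph {R, R'} = (set ?xs, insert {last ?xs, hd ?xs} (path_edges ?xs))"
  proof -
    have "path_edges (u # bs @ [v]) = path_edges (v # rev bs @ [u])"
      using path_edges_rev[of "u # bs @ [v]"] by simp
    also have "\<dots> = path_edges ((v # rev bs) @ [u])" by simp
    also have "\<dots> = path_edges (v # rev bs) \<union> {{last (v # rev bs), u}}"
      by (subst path_edges_append) auto
    finally have "path_edges (u # bs @ [v]) = path_edges (v # rev bs) \<union> {{last ?xs, hd ?xs}}"
      by (simp split: if_splits)
    moreover have "path_edges ?xs = path_edges (u # as @ [v]) \<union> path_edges (v # rev bs)"
      using path_edges_join[of "u # as" v "rev bs"] by simp
    ultimately show ?thesis using R R' by (auto simp: bundle_graph_def)
  qed
  ultimately show ?thesis unfolding cycle_graph_def edges_path_of by blast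
qed

lemma simple_cycle: "cycle_graph C \<Longrightarrow> simple_graph C"
  unfolding cycle_graph_def edges_path_of simple_graph_def
proof (elim exE conjE, intro conjI ballI)
  fix xs e assume xs: "distinct xs" "length xs \<ge> 3"
    and C: "C = (set xs, insert {last xs, hd xs} (path_edges xs))" and e: "e \<in> edges C"
  have "hd xs \<noteq> last xs" "xs \<noteq> []" using xs by (cases xs; cases "tl xs"; auto)+
  then show "e \<subseteq> verts C" "card e = 2"
    using C e xs by (auto dest: path_edges_subset card_path_edge)
qed auto

lemma card_verts_cycle: "cycle_graph C \<Longrightarrow> card (verts C) \<ge> 3"
  unfolding cycle_graph_def by (auto simp: distinct_card)

text \<open>With \<open>w\<close> rotated to the front, its neighbours are the first and the last of
  the remaining vertices, and these differ.\<close>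

lemma cycle_degree:
  assumes "cycle_graph C" and "w \<in> verts C"
  shows "card {f \<in> edges C. w \<in> f} = 2"
proof -
  obtain ys where ys: "distinct (w # ys)" "length ys \<ge> 2"
    "C = (set (w # ys), insert {last ys, w} (path_edges (w # ys)))"
    using cycle_rotate[OF assms] by metis
  then have "ys \<noteq> []" by auto
  have ne: "hd ys \<noteq> last ys" using ys(1,2) by (cases ys; cases "tl ys") auto
  have "w \<notin> \<Union>(path_edges ys)" using ys(1) by (auto dest: path_edges_subset)
  then have "{f \<in> edges C. w \<in> f} = {{w, hd ys}, {w, last ys}}"
    using ys(3) \<open>ys \<noteq> []\<close> by (auto simp: path_edges_Cons)
  moreover have "{w, hd ys} \<noteq> {w, last ys}" using ne by (auto simp: doubleton_eq_iff)
  ultimately show ?thesis by simp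
qed

text \<open>As no vertex is isolated, a cycle is determined by its edge set; this is what
  \<open>cycle_eqI\<close> uses.\<close>

lemma verts_cycle: "cycle_graph C \<Longrightarrow> verts C = \<Union>(edges C)"
proof -
  assume C: "cycle_graph C"
  have "v \<in> \<Union>(edges C)" if "v \<in> verts C" for v
  proof -
    have "{f \<in> edges C. v \<in> f} \<noteq> {}" using cycle_degree[OF C that] by (metis card.empty zero_neq_numeral)
    then show ?thesis by auto
  qed
  then show ?thesis using simple_cycle[OF C] unfolding simple_graph_def by auto
qed

text \<open>Deleting a vertex, rotated to the front, leaves the path through all the others.\<close>

lemma biconn_cycle:
  assumes "cycle_graph C"
  shows "biconn C"
proof -
  have "(u, v) \<in> reach {e \<in> edges C. w \<notin> e}"
    if w: "w \<in> verts C" and uv: "u \<in> verts C - {w}" "v \<in> verts C - {w}" for u v w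
  proof -
    obtain ys where ys: "distinct (w # ys)" "length ys \<ge> 2"
      "C = (set (w # ys), insert {last ys, w} (path_edges (w # ys)))"
      using cycle_rotate[OF assms w] by metis
    then have "(u, v) \<in> reach (path_edges ys)" using uv by (intro reach_in_path) auto
    moreover have "path_edges ys \<subseteq> {e \<in> edges C. w \<notin> e}"
      using ys(1,2) path_edges_subset[of _ ys] unfolding ys(3) by (cases ys) fastforce+
    ultimately show ?thesis by (rule reach_mono)
  qed
  moreover have "(u, v) \<in> reach (edges C)" if "u \<in> verts C" "v \<in> verts C" for u v
  proof -
    obtain xs where "C = (set xs, insert {last xs, hd xs} (path_edges xs))"
      using assms(1) unfolding cycle_graph_def edges_path_of by auto
    then show ?thesis using that reach_in_path[of u xs v] by (auto intro: reach_mono)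
  qed
  ultimately show ?thesis
    unfolding biconn_iff using simple_cycle[OF assms] card_verts_cycle[OF assms] by auto
qed

section \<open>Ears and common cycles\<close>

abbreviation cycles_through :: "'a ugraph \<Rightarrow> 'a set \<Rightarrow> 'a ugraph set" where
  "cycles_through G e \<equiv> {C. cycle_graph C \<and> subgraph C G \<and> e \<in> edges C}"

section \<open>Finiteness and monotonicity of cycle counts\<close>

lemma finite_edges: "simple_graph G \<Longrightarrow> finite (edges G)"
  unfolding simple_graph_def by (meson Pow_iff finite_Pow_iff finite_subset subsetI)

lemma finite_subgraphs:
  assumes "simple_graph G"
  shows "finite {H. subgraph H G}"
proof (rule finite_subset)
  show "{H. subgraph H G} \<subseteq> Pow (verts G) \<times> Pow (edges G)"
    unfolding subgraph_def by (auto simp: mem_Times_iff)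
  show "finite (Pow (verts G) \<times> Pow (edges G))"
    using assms finite_edges[OF assms] unfolding simple_graph_def by auto
qed

lemma finite_cycles_through: "simple_graph G \<Longrightarrow> finite (cycles_through G e)"
  using finite_subgraphs[of G] by (rule finite_subset[rotated]) auto

lemma subgraph_trans: "subgraph F G \<Longrightarrow> subgraph G H \<Longrightarrow> subgraph F H"
  unfolding subgraph_def by auto

lemma card_cycles_mono:
  assumes "subgraph F G" and "simple_graph G"
  shows "card (cycles_through F e) \<le> card (cycles_through G e)"
  using assms by (intro card_mono finite_cycles_through) (auto intro: subgraph_trans)

text \<open>As \<open>q\<close> is no cut-vertex, a path avoiding \<open>q\<close> leads from
  \<open>r\<close> to a first vertex of \<open>F\<close> other than \<open>q\<close>. Prefixed by
  \<open>q\<close>, it is an ear that starts with the given edge; if \<open>r\<close> is itself in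
  \<open>F\<close>, the ear is that edge alone.\<close>

lemma ear_at_edge:
  assumes B: "biconn B" and F: "simple_graph F" "verts F \<subseteq> verts B"
    and qr: "{q, r} \<in> edges B" "{q, r} \<notin> edges F" "q \<in> verts F" and s: "s \<in> verts F" "s \<noteq> q"
  obtains Q where "attached F Q" "path_in B Q" "{q, r} \<in> path_edges Q"
proof -
  have sB: "e \<subseteq> verts B" "card e = 2" if "e \<in> edges B" for e
    using B that unfolding biconn_iff simple_graph_def by auto
  have "q \<noteq> r" "r \<in> verts B" using sB[OF qr(1)] by (cases "q = r"; simp)+
  then have "(r, s) \<in> reach {e \<in> edges B. q \<notin> e}"
    using biconn_avoiding[OF B] s F(2) by auto
  then obtain xs where xs: "xs \<noteq> []" "distinct xs" "hd xs = r" "last xs \<in> verts F - {q}"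
    "set (butlast xs) \<inter> (verts F - {q}) = {}" "path_edges xs \<subseteq> {e \<in> edges B. q \<notin> e}"
    using reach_first_hit[of r s "{e \<in> edges B. q \<notin> e}" "verts F - {q}"] s by blast
  have V: "set xs \<subseteq> verts B - {q}"
  proof (cases "length xs \<ge> 2")
    case True
    then show ?thesis using path_edges_cover[OF True] xs(6) sB(1) by blast
  next
    case False
    then obtain x where "xs = [x]" using xs(1) by (cases xs; cases "tl xs") auto
    then show ?thesis using xs(3) \<open>q \<noteq> r\<close> \<open>r \<in> verts B\<close> by auto
  qed
  let ?Q = "q # xs"
  have d: "distinct ?Q" using V xs(2) by auto
  have e: "{q, r} \<in> path_edges ?Q" using xs(1,3) by (simp add: path_edges_Cons)
  have sub: "path_edges ?Q \<subseteq> edges B" using xs(1,3,6) qr(1) by (auto simp: path_edges_Cons)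
  have "set xs = insert (last xs) (set (butlast xs))"
    using xs(1) by (metis append_butlast_last_id list.simps(15) rotate1.simps(2) set_rotate1)
  then have int: "(set ?Q - {q, last xs}) \<inter> verts F = {}" using xs(5) by auto
  \<comment> \<open>A common edge would join the two ends of the ear, so the ear would be the edge
    from \<open>q\<close> to \<open>r\<close>, which is not in \<open>F\<close>.\<close>
  have "path_edges ?Q \<inter> edges F = {}"
  proof (rule ccontr)
    assume "path_edges ?Q \<inter> edges F \<noteq> {}"
    then obtain f where f: "f \<in> path_edges ?Q" "f \<in> edges F" by auto
    then have "f \<subseteq> set ?Q" "f \<subseteq> verts F" using F(1) path_edges_subset unfolding simple_graph_def by blast+
    then have "f \<subseteq> {q, last xs}" using int by blast
    then have "?Q = [q, last xs]" using path_edge_ends[OF d f(1)] xs(1) by simp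
    then have "xs = [r]" using xs(3) by (metis list.inject list.sel(1))
    then show False using f qr(2) by auto
  qed
  then have "attached F ?Q"
    unfolding attached_def using d xs(1,4) int qr(3) by (cases xs) auto
  moreover have "path_in B ?Q" unfolding path_in_iff using d V sub F(2) qr(3) by auto
  ultimately show thesis using that e by blast
qed

text \<open>If every edge of \<open>B\<close> that meets \<open>F\<close> belonged to
  \<open>F\<close>, connectedness would spread \<open>F\<close> over all of \<open>B\<close>. So
  some missing edge starts in \<open>F\<close>, and \<open>ear_at_edge\<close> extends it.\<close>

lemma ear_exists:
  assumes B: "biconn B" and F: "subgraph F B" "F \<noteq> B" and st: "s \<in> verts F" "t \<in> verts F" "s \<noteq> t"
  obtains Q where "attached F Q" "path_in B Q"
proof -
  have "\<exists>q r. {q, r} \<in> edges B \<and> {q, r} \<notin> edges F \<and> q \<in> verts F"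
  proof (rule ccontr)
    assume "\<not> ?thesis"
    then have closed: "{q, r} \<in> edges F" if "{q, r} \<in> edges B" "q \<in> verts F" for q r
      using that by blast
    have "v \<in> verts F" if "v \<in> verts B" for v
    proof -
      have "(s, v) \<in> reach (edges B)" using B that st(1) F(1) unfolding biconn_iff subgraph_def by blast
      then show ?thesis unfolding reach_def
      proof (induction rule: rtrancl_induct)
        case (step y z)
        then have "{y, z} \<in> edges F" using closed by auto
        then show ?case using F(1) unfolding subgraph_def simple_graph_def by auto
      qed (fact st(1))
    qed
    moreover have "e \<in> edges F" if "e \<in> edges B" for e
    proof -
      have "card e = 2" "e \<subseteq> verts B" using B that unfolding biconn_iff simple_graph_def by auto
      then obtain q r where "e = {q, r}" "q \<in> verts B" by (auto simp: card_2_iff)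
      then show ?thesis using closed that \<open>\<And>v. v \<in> verts B \<Longrightarrow> v \<in> verts F\<close> by blast
    qed
    ultimately have "F = B" using F(1) unfolding subgraph_def by (intro prod_eqI) auto
    then show False using F(2) by simp
  qed
  then obtain q r where qr: "{q, r} \<in> edges B" "{q, r} \<notin> edges F" "q \<in> verts F" by auto
  obtain s' where "s' \<in> verts F" "s' \<noteq> q" using st by metis
  then show thesis using ear_at_edge[OF B _ _ qr] F(1) that unfolding subgraph_def by metis
qed

text \<open>The ends of the ear split the cycle into two arcs, giving three parallel paths.\<close>

lemma cycle_ear_bundle:
  assumes C: "cycle_graph C" and Q: "attached C Q"
  obtains R R' where "R \<noteq> R'" "Q \<noteq> R" "Q \<noteq> R'" "path_bundle (hd Q) (last Q) {Q, R, R'}" "C = bundle_graph {R, R'}"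
proof -
  have "hd Q \<noteq> last Q" using Q unfolding attached_def by (cases Q; cases "tl Q") auto
  then obtain R R' where R: "R \<noteq> R'" "path_bundle (hd Q) (last Q) {R, R'}" "C = bundle_graph {R, R'}"
    using cycle_bundle[OF C, of "hd Q" "last Q"] Q unfolding attached_def by metis
  then show thesis using bundle_insert[OF R(2) _ Q[unfolded R(3)]] that[of R R'] by auto
qed

lemma subgraph_bundle_graph:
  assumes "path_bundle u v S" and "\<And>P. P \<in> S \<Longrightarrow> set P \<subseteq> verts G \<and> path_edges P \<subseteq> edges G"
  shows "subgraph (bundle_graph S) G"
  using simple_bundle_graph[OF assms(1)] assms(2) unfolding subgraph_def by auto

text \<open>An ear of \<open>C\<close> through the new edge splits \<open>C\<close> into two arcs;
  the ear and the arc that carries \<open>e\<close> form the new cycle.\<close>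

lemma cycle_exchange:
  assumes B: "biconn B" and C: "cycle_graph C" "subgraph C B" "e \<in> edges C"
    and qr: "{q, r} \<in> edges B" "q \<in> verts C"
  obtains C' where "cycle_graph C'" "subgraph C' B" "e \<in> edges C'" "{q, r} \<in> edges C'"
proof (cases "{q, r} \<in> edges C")
  case True
  then show thesis using that C by blast
next
  case False
  have "verts C \<noteq> {q}" using card_verts_cycle[OF C(1)] by auto
  then obtain s where s: "s \<in> verts C" "s \<noteq> q" using qr(2) by auto
  obtain Q where Q: "attached C Q" "path_in B Q" "{q, r} \<in> path_edges Q"
    using ear_at_edge[OF B simple_cycle[OF C(1)] _ qr(1) False qr(2) s] C(2)
    unfolding subgraph_def by metis
  obtain R R' where R: "R \<noteq> R'" "Q \<noteq> R" "Q \<noteq> R'" "path_bundle (hd Q) (last Q) {Q, R, R'}"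
    "C = bundle_graph {R, R'}"
    using cycle_ear_bundle[OF C(1) Q(1)] by metis
  obtain T where T: "T \<in> {R, R'}" "e \<in> path_edges T" using C(3) R(5) by auto
  then have b: "path_bundle (hd Q) (last Q) {Q, T}" "Q \<noteq> T" using R by (auto intro: bundle_subset)
  have "set T \<subseteq> verts B" "path_edges T \<subseteq> edges B"
    using T C(2) R(5) unfolding subgraph_def by auto
  then have "subgraph (bundle_graph {Q, T}) B"
    using Q(2) by (intro subgraph_bundle_graph[OF b(1)]) (auto simp: path_in_iff)
  then show thesis using that[of "bundle_graph {Q, T}"] bundle_cycle[OF b] T Q(3) by auto
qed

text \<open>An ear of the one-edge subgraph must join the two ends of \<open>e\<close>, and together
  with \<open>e\<close> it closes a cycle. The third vertex ensures that this subgraph is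
  proper.\<close>

lemma cycle_through_edge:
  assumes B: "biconn B" "card (verts B) \<ge> 3" and e: "e \<in> edges B"
  obtains C where "cycle_graph C" "subgraph C B" "e \<in> edges C"
proof -
  have "card e = 2" "e \<subseteq> verts B" using B(1) e unfolding biconn_iff simple_graph_def by auto
  then obtain a b where ab: "e = {a, b}" "a \<noteq> b" by (auto simp: card_2_iff)
  let ?F = "({a, b}, {{a, b}})"
  have "?F \<noteq> B" using B(2) ab by auto
  moreover have "subgraph ?F B"
    using ab e \<open>e \<subseteq> verts B\<close> unfolding subgraph_def simple_graph_def by auto
  ultimately obtain Q where Q: "attached ?F Q" "path_in B Q"
    using ear_exists[OF B(1), of ?F a b] ab by auto
  \<comment> \<open>The ear may run from \<open>a\<close> to \<open>b\<close> or from
    \<open>b\<close> to \<open>a\<close>; \<open>u\<close> and \<open>v\<close> follow its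
    direction.\<close>
  define u v where "u = hd Q" and "v = last Q"
  have "u \<noteq> v" using Q(1) unfolding attached_def u_def v_def by (cases Q; cases "tl Q") auto
  moreover have "u \<in> {a, b}" "v \<in> {a, b}" using Q(1) unfolding attached_def u_def v_def by auto
  ultimately have uv: "{a, b} = {u, v}" by auto
  then have F: "?F = bundle_graph {[u, v]}" by (simp add: bundle_graph_def)
  have b1: "path_bundle u v {[u, v]}" using \<open>u \<noteq> v\<close> by (simp add: path_bundle_def)
  have "attached (bundle_graph {[u, v]}) Q" using Q(1) unfolding F .
  note * = bundle_insert[OF b1 _ this u_def[symmetric] v_def[symmetric]]
  have b: "path_bundle u v {Q, [u, v]}" "Q \<noteq> [u, v]" using * by blast+
  have e': "e = {u, v}" using uv ab by simp
  then have "set [u, v] \<subseteq> verts B" "path_edges [u, v] \<subseteq> edges B"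
    using e \<open>e \<subseteq> verts B\<close> by auto
  then have "subgraph (bundle_graph {Q, [u, v]}) B"
    using Q(2) by (intro subgraph_bundle_graph[OF b(1)]) (auto simp: path_in_iff)
  then show thesis using bundle_cycle[OF b] e' by (intro that[of "bundle_graph {Q, [u, v]}"]) auto
qed

text \<open>A cycle through \<open>e\<close> is moved along a walk towards \<open>f\<close> by
  repeated exchange, always passing through the current vertex; a last exchange at an end of
  \<open>f\<close> puts \<open>f\<close> itself on the cycle.\<close>

lemma common_cycle:
  assumes B: "biconn B" "card (verts B) \<ge> 3" and e: "e \<in> edges B" and f: "f \<in> edges B"
  obtains C where "cycle_graph C" "subgraph C B" "e \<in> edges C" "f \<in> edges C"
proof -
  obtain C0 where C0: "cycle_graph C0" "subgraph C0 B" "e \<in> edges C0"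
    using cycle_through_edge[OF B e] by metis
  then obtain a where a: "a \<in> verts C0" using card_verts_cycle[OF C0(1)] by fastforce
  have "\<exists>C\<in>cycles_through B e. v \<in> verts C" if v: "v \<in> verts B" for v
  proof -
    have "(a, v) \<in> reach (edges B)" using B(1) v a C0(2) unfolding biconn_iff subgraph_def by blast
    then show ?thesis unfolding reach_def
    proof (induction rule: rtrancl_induct)
      case base
      then show ?case using C0 a by blast
    next
      case (step y z)
      then obtain C where C: "cycle_graph C" "subgraph C B" "e \<in> edges C" "y \<in> verts C" by auto
      obtain C' where "cycle_graph C'" "subgraph C' B" "e \<in> edges C'" "{y, z} \<in> edges C'"
        using cycle_exchange[OF B(1) C(1-3) _ C(4)] step(2) by auto
      then show ?case unfolding subgraph_def simple_graph_def by blast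
    qed
  qed note * = this
  have "card f = 2" "f \<subseteq> verts B" using B(1) f unfolding biconn_iff simple_graph_def by auto
  then obtain q r where qr: "f = {q, r}" "q \<in> verts B" by (auto simp: card_2_iff)
  obtain C where C: "cycle_graph C" "subgraph C B" "e \<in> edges C" "q \<in> verts C" using *[OF qr(2)] by auto
  show thesis using cycle_exchange[OF B(1) C(1-3) _ C(4)] f qr(1) that by metis
qed

text \<open>An ear of \<open>F\<close> supplies an edge \<open>f\<close> of \<open>B\<close> outside
  \<open>F\<close>. A common cycle of \<open>e\<close> and \<open>f\<close> is counted in
  \<open>B\<close> but not in \<open>F\<close>.\<close>

lemma card_cycles_strict_mono:
  assumes B: "biconn B" "card (verts B) \<ge> 3" and F: "subgraph F B" "F \<noteq> B" and e: "e \<in> edges F"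
  shows "card (cycles_through F e) < card (cycles_through B e)"
proof -
  have "card e = 2" "e \<subseteq> verts F" using F(1) e unfolding subgraph_def simple_graph_def by auto
  then obtain s t where "s \<in> verts F" "t \<in> verts F" "s \<noteq> t" by (auto simp: card_2_iff)
  then obtain Q where Q: "attached F Q" "path_in B Q" using ear_exists[OF B(1) F] by metis
  then have "path_edges Q \<noteq> {}" unfolding attached_def by (simp add: path_edges_empty_iff)
  then obtain f where f: "f \<in> edges B" "f \<notin> edges F"
    using Q unfolding attached_def path_in_iff by blast
  obtain C where C: "cycle_graph C" "subgraph C B" "e \<in> edges C" "f \<in> edges C"
    using common_cycle[OF B _ f(1)] e F(1) unfolding subgraph_def by blast
  then have "C \<in> cycles_through B e - cycles_through F e" using f(2) unfolding subgraph_def by auto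
  then have "cycles_through F e \<subset> cycles_through B e"
    using F(1) subgraph_trans by blast
  then show ?thesis
    using B(1) by (intro psubset_card_mono finite_cycles_through) (auto simp: biconn_iff)
qed

section \<open>Lower bounds on the number of cycles\<close>

text \<open>The path through \<open>e\<close> closes a cycle with each other path. These cycles
  differ because the paths have disjoint, nonempty edge sets.\<close>

lemma bundle_cycles_lower:
  assumes S: "path_bundle u v S" and P: "P \<in> S" and e: "e \<in> path_edges P"
  shows "card S - 1 \<le> card (cycles_through (bundle_graph S) e)"
proof -
  have inj: "inj_on (\<lambda>P'. bundle_graph {P, P'}) (S - {P})"
  proof (rule inj_onI, rule ccontr)
    fix P1 P2 assume *: "P1 \<in> S - {P}" "P2 \<in> S - {P}" "bundle_graph {P, P1} = bundle_graph {P, P2}" "P1 \<noteq> P2"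
    then have "path_edges P \<union> path_edges P1 = path_edges P \<union> path_edges P2"
      by (auto simp: bundle_graph_def)
    moreover have "path_edges P1 \<inter> path_edges P = {}" "path_edges P1 \<inter> path_edges P2 = {}"
      using bundle_edges_disjoint[OF S] P * by auto
    ultimately have "path_edges P1 = {}" by blast
    then show False using bundle_path(6)[OF S, of P1] * by (auto simp: path_edges_empty_iff)
  qed
  have "cycle_graph (bundle_graph {P, P'})" "subgraph (bundle_graph {P, P'}) (bundle_graph S)"
    if "P' \<in> S - {P}" for P'
  proof -
    have b: "path_bundle u v {P, P'}" using bundle_subset[OF S] P that by auto
    show "cycle_graph (bundle_graph {P, P'})" using bundle_cycle[OF b] that by auto
    show "subgraph (bundle_graph {P, P'}) (bundle_graph S)"
      using P that by (intro subgraph_bundle_graph[OF b]) auto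
  qed
  then have "(\<lambda>P'. bundle_graph {P, P'}) ` (S - {P}) \<subseteq> cycles_through (bundle_graph S) e"
    using e by auto
  from card_inj_on_le[OF inj this finite_cycles_through[OF simple_bundle_graph[OF S]]]
  show ?thesis using P S by (simp add: path_bundle_def)
qed

text \<open>The ear closes a cycle with either arc of \<open>D\<close>. The upper bounds on the edge
  sets serve to tell the cycles of two different ears apart.\<close>

lemma two_cycles_through_ear:
  assumes D: "cycle_graph D" "subgraph D H" and W: "attached D W" "path_in H W"
  obtains C1 C2 where "C1 \<noteq> C2" "cycle_graph C1" "cycle_graph C2" "subgraph C1 H" "subgraph C2 H"
    "path_edges W \<subseteq> edges C1" "path_edges W \<subseteq> edges C2"
    "edges C1 \<subseteq> edges D \<union> path_edges W" "edges C2 \<subseteq> edges D \<union> path_edges W"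
proof -
  obtain R R' where R: "R \<noteq> R'" "W \<noteq> R" "W \<noteq> R'" "path_bundle (hd W) (last W) {W, R, R'}"
    "D = bundle_graph {R, R'}"
    using cycle_ear_bundle[OF D(1) W(1)] by metis
  have b: "path_bundle (hd W) (last W) {W, R}" "path_bundle (hd W) (last W) {W, R'}"
    using R(4) by (auto intro: bundle_subset)
  have "path_edges R \<noteq> {}" using bundle_path(6)[OF R(4), of R] by (simp add: path_edges_empty_iff)
  moreover have "path_edges R \<inter> path_edges W = {}" "path_edges R \<inter> path_edges R' = {}"
    using bundle_edges_disjoint[OF R(4)] R(1-3) by auto
  ultimately have "edges (bundle_graph {W, R}) \<noteq> edges (bundle_graph {W, R'})" by auto
  then have "bundle_graph {W, R} \<noteq> bundle_graph {W, R'}" by metis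
  moreover have "subgraph (bundle_graph {W, R}) H" "subgraph (bundle_graph {W, R'}) H"
    using W(2) D(2) R(5)
    by (intro subgraph_bundle_graph[OF b(1)] subgraph_bundle_graph[OF b(2)]; auto simp: path_in_iff subgraph_def)+
  ultimately show thesis
    using bundle_cycle[OF b(1) R(2)] bundle_cycle[OF b(2) R(3)] R(5)
    by (intro that[of "bundle_graph {W, R}" "bundle_graph {W, R'}"]) auto
qed

text \<open>Each ear yields two cycles through the shared edge \<open>e\<close>. The edge
  \<open>e2\<close> lies on both cycles of \<open>P\<close> and on neither cycle of
  \<open>W\<close>, so the four are distinct.\<close>

lemma four_cycles_through_two_ears:
  assumes H: "simple_graph H" and D: "cycle_graph D" "subgraph D H"
    and P: "attached D P" "path_in H P" and W: "attached D W" "path_in H W"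
    and e: "e \<in> path_edges P" "e \<in> path_edges W" and e2: "e2 \<in> path_edges P" "e2 \<notin> path_edges W"
  shows "card (cycles_through H e) \<ge> 4"
proof -
  obtain C1 C2 where C: "C1 \<noteq> C2" "cycle_graph C1" "cycle_graph C2" "subgraph C1 H" "subgraph C2 H"
    "path_edges P \<subseteq> edges C1" "path_edges P \<subseteq> edges C2"
    using two_cycles_through_ear[OF D P] by metis
  obtain C3 C4 where C': "C3 \<noteq> C4" "cycle_graph C3" "cycle_graph C4" "subgraph C3 H" "subgraph C4 H"
    "path_edges W \<subseteq> edges C3" "path_edges W \<subseteq> edges C4"
    "edges C3 \<subseteq> edges D \<union> path_edges W" "edges C4 \<subseteq> edges D \<union> path_edges W"
    using two_cycles_through_ear[OF D W] by metis
  have "e2 \<notin> edges D" using P(1) e2 unfolding attached_def by auto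
  then have "e2 \<notin> edges C3" "e2 \<notin> edges C4" using C' e2 by auto
  moreover have "e2 \<in> edges C1" "e2 \<in> edges C2" using C(6,7) e2(1) by auto
  ultimately have "{C1, C2} \<inter> {C3, C4} = {}" by blast
  then have "card {C1, C2, C3, C4} = 4" using C(1) C'(1) by auto
  moreover have "{C1, C2, C3, C4} \<subseteq> cycles_through H e" using C C' e by blast
  then have "card {C1, C2, C3, C4} \<le> card (cycles_through H e)"
    by (rule card_mono[OF finite_cycles_through[OF H]])
  ultimately show ?thesis by simp
qed

text \<open>\<open>Q\<close> leaves the ear \<open>P\<close> at its inner vertex \<open>x\<close>. A
  second ear \<open>W\<close> of \<open>D\<close> follows \<open>P\<close> along \<open>A\<close> to
  \<open>x\<close> and then turns into \<open>Q\<close>; it shares with \<open>P\<close> the edge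
  into \<open>x\<close> but misses the next edge of \<open>P\<close>. The assumption on
  \<open>last Q\<close> ensures that this detour does not lead back to \<open>A\<close>.\<close>

lemma four_cycles_aux:
  assumes D: "cycle_graph D" and P: "attached D P" "P = A @ x # B" "A \<noteq> []" "B \<noteq> []"
    and Q: "attached (graph_union D (path_of P)) Q" "hd Q = x"
    and y: "last Q \<in> verts D \<and> last Q \<noteq> hd P \<or> last Q \<in> set B"
    and H: "H = graph_union (graph_union D (path_of P)) (path_of Q)"
  shows "\<exists>e\<in>edges H. card (cycles_through H e) \<ge> 4"
proof -
  define u v y where "u = hd P" and "v = last P" and "y = last Q"
  have dP: "distinct P" and PD: "set P \<inter> verts D = {u, v}" and eP: "path_edges P \<inter> edges D = {}"
  proof -
    show "distinct P" "path_edges P \<inter> edges D = {}" using P(1) unfolding attached_def by auto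
    have "P \<noteq> []" using P(2) by simp
    then have "u \<in> set P" "v \<in> set P" unfolding u_def v_def by simp_all
    then show "set P \<inter> verts D = {u, v}" using P(1) unfolding attached_def u_def v_def by blast
  qed
  have dQ: "distinct Q" and QD: "set Q \<inter> (verts D \<union> set P) \<subseteq> {x, y}" and lQ: "length Q \<ge> 2"
    and eQ: "path_edges Q \<inter> (edges D \<union> path_edges P) = {}"
    using Q unfolding attached_def y_def graph_union_def path_of_eq by auto
  obtain Q1 where Q1: "Q = x # Q1" using lQ Q(2) by (cases Q) auto
  with lQ have "Q1 \<noteq> []" by auto
  have xy: "x \<noteq> y" using dQ Q1 \<open>Q1 \<noteq> []\<close> unfolding y_def by auto
  have u: "u = hd A" "u \<in> set A" and v: "v = last B" "v \<in> set B"
    using P(2-4) unfolding u_def v_def by auto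
  have xD: "x \<notin> verts D"
  proof
    assume "x \<in> verts D"
    then have "x \<in> {u, v}" using PD P(2) by auto
    then show False using u(2) v(2) dP P(2) by auto
  qed
  have sH: "simple_graph H"
    unfolding H using simple_cycle[OF D] dP dQ
    by (auto simp: simple_graph_def graph_union_def path_of_eq dest: path_edges_subset card_path_edge)
  have PE: "path_edges P = path_edges A \<union> path_edges (x # B) \<union> {{last A, x}}"
    using P(2,3) by (simp add: path_edges_append)
  have DH: "subgraph D H" and PH: "path_in H P"
    using simple_cycle[OF D] dP P(2) unfolding H path_in_iff subgraph_def
    by (auto simp: graph_union_def path_of_eq)
  have eP1: "{last A, x} \<in> path_edges P" and eP2: "{x, hd B} \<in> path_edges P"
    using PE P(4) by (auto simp: path_edges_Cons)
  \<comment> \<open>The shared edge is the one before \<open>x\<close>; the edge after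
    \<open>x\<close> distinguishes the two ears.\<close>
  have final: ?thesis
    if W: "attached D W" "path_in H W" "{last A, x} \<in> path_edges W" "{x, hd B} \<notin> path_edges W" for W
    using four_cycles_through_two_ears[OF sH D DH P(1) PH W(1,2) eP1 W(3) eP2 W(4)] eP1 PH
    unfolding path_in_iff by blast
  have AE: "{x, hd B} \<notin> path_edges A" "{x, hd B} \<noteq> {last A, x}"
  proof -
    have *: "x \<notin> set A" "set A \<inter> set B = {}" using dP P(2) by auto
    then show "{x, hd B} \<notin> path_edges A" using path_edges_subset[of "{x, hd B}" A] by auto
    have "hd B \<noteq> last A" using * hd_in_set[OF P(4)] last_in_set[OF P(3)] by auto
    then show "{x, hd B} \<noteq> {last A, x}" by (auto simp: doubleton_eq_iff)
  qed
  have QE: "{x, hd B} \<notin> path_edges Q" using eQ eP2 by auto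
  show ?thesis
  proof (cases "y \<in> set B")
    case True
    then obtain M B1 where B: "B = M @ y # B1" by (auto dest: split_list)
    \<comment> \<open>\<open>Q\<close> returns to \<open>P\<close> beyond \<open>x\<close>, so
      \<open>W\<close> finishes along \<open>P\<close>. If \<open>Q\<close> ends at
      \<open>v\<close>, then \<open>B1\<close> is empty.\<close>
    let ?W = "A @ Q @ B1"
    have Q0: "Q = butlast Q @ [y]" unfolding y_def using lQ by (cases Q) auto
    have "path_edges (Q @ B1) = path_edges Q \<union> path_edges (y # B1)"
      using path_edges_join[of "butlast Q" y B1] Q0 by (metis append.assoc append_Cons append_Nil)
    then have WE: "path_edges ?W = path_edges A \<union> path_edges Q \<union> path_edges (y # B1) \<union> {{last A, x}}"
      using path_edges_append[OF P(3), of "Q @ B1"] Q1 by auto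
    have "path_edges (x # B) = path_edges ((x # M) @ [y]) \<union> path_edges (y # B1)"
      using path_edges_join[of "x # M" y B1] B by simp
    then have sub: "path_edges ?W \<subseteq> path_edges P \<union> path_edges Q" using PE WE by auto
    have dW: "distinct ?W" using dP P(2) B dQ QD by auto
    have lW: "last ?W = v" using v B lQ unfolding y_def by (cases B1; cases Q) auto
    have hW: "hd ?W = u" using u P(3) by simp
    have "set ?W \<inter> verts D \<subseteq> {u, v}" using PD QD P(2) B xD by auto
    then have "attached D ?W"
      unfolding attached_def using dW lQ lW hW PD sub eP eQ by auto
    moreover have "path_in H ?W"
      unfolding path_in_iff using dW sub P(2) B lQ
      by (auto simp: H graph_union_def path_of_eq)
    moreover have "{x, hd B} \<notin> path_edges (y # B1)"
      using path_edges_subset[of "{x, hd B}" "y # B1"] dP P(2) B by auto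
    ultimately show ?thesis using final[of ?W] WE AE QE by auto
  next
    case False
    then have yD: "y \<in> verts D" "y \<noteq> u" using y unfolding y_def u_def by auto
    then have yP: "y \<notin> set P" using PD v False by auto
    \<comment> \<open>\<open>Q\<close> ends on \<open>D\<close> outside \<open>P\<close>, so
      \<open>W\<close> can stop there.\<close>
    let ?W = "A @ Q"
    have WE: "path_edges ?W = path_edges A \<union> path_edges Q \<union> {{last A, x}}"
      using path_edges_append[OF P(3), of Q] Q1 by auto
    then have sub: "path_edges ?W \<subseteq> path_edges P \<union> path_edges Q" using PE by auto
    have dW: "distinct ?W" using dP P(2) dQ QD yP by auto
    have lW: "last ?W = y" using Q1 unfolding y_def by simp
    have hW: "hd ?W = u" using u P(3) by simp
    have "v \<notin> set A" using v(2) dP P(2) by auto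
    then have "set ?W \<inter> verts D \<subseteq> {u, y}" using PD QD P(2) xD by auto
    then have "attached D ?W"
      unfolding attached_def using dW lQ lW hW PD sub eP eQ yD by auto
    moreover have "path_in H ?W"
      unfolding path_in_iff using dW sub P(2) lQ
      by (auto simp: H graph_union_def path_of_eq)
    ultimately show ?thesis using final[of ?W] WE AE QE by auto
  qed
qed

text \<open>Some end of \<open>Q\<close> is an inner vertex of one path \<open>P\<close>. The other
  two paths form the cycle \<open>D\<close>, of which \<open>P\<close> is an ear, so
  \<open>four_cycles_aux\<close> applies after reversing \<open>Q\<close> or \<open>P\<close> where
  necessary.\<close>

lemma four_cycles_crossing_ear:
  assumes S: "path_bundle u v S" "card S = 3" and Q: "attached (bundle_graph S) Q"
    and ends: "{hd Q, last Q} \<noteq> {u, v}" and H: "H = graph_union (bundle_graph S) (path_of Q)"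
  shows "\<exists>e\<in>edges H. card (cycles_through H e) \<ge> 4"
proof -
  have main: "\<exists>e\<in>edges H. card (cycles_through H e) \<ge> 4"
    if Q: "attached (bundle_graph S) Q" and x: "hd Q \<notin> {u, v}"
      and H: "H = graph_union (bundle_graph S) (path_of Q)" for Q
  proof -
    obtain P where P: "P \<in> S" "hd Q \<in> set P" using Q unfolding attached_def by auto
    have "card (S - {P}) = 2" using S P by (simp add: path_bundle_def)
    then obtain R R' where R: "S - {P} = {R, R'}" "R \<noteq> R'" by (auto simp: card_2_iff)
    define D where "D = bundle_graph {R, R'}"
    have b: "path_bundle u v {R, R'}" using bundle_subset[OF S(1)] R(1) by blast
    have D: "cycle_graph D" unfolding D_def using bundle_cycle[OF b R(2)] .
    have Seq: "S = insert P {R, R'}" using P R by auto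
    have bP: "distinct P" "length P \<ge> 2" "hd P = u" "last P = v" "u \<noteq> v" "u \<in> set P" "v \<in> set P"
      using bundle_path[OF S(1) P(1)] by auto
    have int: "set P \<inter> set R = {u, v}" "set P \<inter> set R' = {u, v}"
      using bundle_inter[OF S(1)] P R by blast+
    have "path_edges P \<inter> path_edges R = {}" "path_edges P \<inter> path_edges R' = {}"
      using bundle_edges_disjoint[OF S(1)] P R by blast+
    then have att: "attached D P" unfolding attached_def D_def using bP int by auto
    have uvD: "u \<in> verts D" "v \<in> verts D" unfolding D_def using int by auto
    obtain A B where AB: "P = A @ hd Q # B" using P(2) by (auto dest: split_list)
    have ne: "A \<noteq> []" "B \<noteq> []" using AB bP x by (auto split: if_splits)
    have SD: "bundle_graph S = graph_union D (path_of P)"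
      unfolding Seq D_def by (rule bundle_graph_insert)
    have "hd Q \<noteq> last Q" using Q unfolding attached_def by (cases Q; cases "tl Q") auto
    moreover have "last Q \<in> verts D \<union> set P"
      using Q unfolding attached_def SD graph_union_def path_of_eq by auto
    \<comment> \<open>Wherever \<open>Q\<close> ends, one of the two directions of \<open>P\<close>
      satisfies the assumption of \<open>four_cycles_aux\<close>.\<close>
    ultimately consider "last Q \<in> verts D \<and> last Q \<noteq> u \<or> last Q \<in> set B"
      | "last Q \<in> verts D \<and> last Q \<noteq> v \<or> last Q \<in> set A"
      using AB bP(5) by auto
    then show ?thesis
    proof cases
      case 1
      then show ?thesis
        using four_cycles_aux[OF D att AB ne _ refl, of H] Q H bP(3) unfolding SD by blast
    next
      case 2
      have r: "rev P = rev B @ hd Q # rev A" using AB by simp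
      have "path_of (rev P) = path_of P" by (simp add: path_of_eq)
      then show ?thesis
        using four_cycles_aux[OF D _ r, of Q H] 2 ne Q H bP att
        unfolding SD by (simp add: attached_rev hd_rev)
    qed
  qed
  consider "hd Q \<notin> {u, v}" | "last Q \<notin> {u, v}"
  proof -
    have "hd Q \<noteq> last Q" using Q unfolding attached_def by (cases Q; cases "tl Q") auto
    then have "\<not> (hd Q \<in> {u, v} \<and> last Q \<in> {u, v})" using ends by auto
    then show thesis using that by blast
  qed
  then show ?thesis
  proof cases
    case 1
    then show ?thesis using main[OF Q _ H] by blast
  next
    case 2
    have "path_of (rev Q) = path_of Q" by (simp add: path_of_eq)
    then show ?thesis using main[of "rev Q"] Q H 2 by (simp add: attached_rev hd_rev)
  qed
qed

section \<open>Theta graphs as bundles\<close>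

text \<open>An inner vertex lies on one path only, so all its edges are the two path edges there.
  This excludes degree 3 for such an end of an ear.\<close>

lemma bundle_inner_degree:
  assumes S: "path_bundle u v S" and w: "w \<in> verts (bundle_graph S)" "w \<notin> {u, v}"
  shows "degree (bundle_graph S) w \<le> 2"
proof -
  obtain P where P: "P \<in> S" "w \<in> set P" using w by auto
  obtain A B where AB: "P = A @ w # B" using P(2) by (auto dest: split_list)
  have bP: "distinct P" "hd P = u" "last P = v" using bundle_path[OF S P(1)] by auto
  have ne: "A \<noteq> []" "B \<noteq> []" using AB bP w(2) by (auto split: if_splits)
  have PE: "path_edges P = path_edges A \<union> path_edges B \<union> {{last A, w}, {w, hd B}}"
    using AB ne by (auto simp: path_edges_append path_edges_Cons)
  have "{f \<in> edges (bundle_graph S). w \<in> f} \<subseteq> {{last A, w}, {w, hd B}}"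
  proof
    fix f assume f: "f \<in> {f \<in> edges (bundle_graph S). w \<in> f}"
    then obtain P' where P': "P' \<in> S" "f \<in> path_edges P'" "w \<in> f" by auto
    then have "w \<in> set P'" using path_edges_subset by blast
    then have "P' = P" using bundle_inter[OF S P(1) P'(1)] P(2) w(2) by blast
    moreover have "f \<notin> path_edges A" "f \<notin> path_edges B"
      using path_edges_subset[of f A] path_edges_subset[of f B] P'(3) bP(1) AB by auto
    ultimately show "f \<in> {{last A, w}, {w, hd B}}" using P'(2) PE by auto
  qed
  then have "card {f \<in> edges (bundle_graph S). w \<in> f} \<le> card {{last A, w}, {w, hd B}}"
    by (intro card_mono) auto
  also have "\<dots> \<le> 2" by (simp add: card_insert_if)
  finally show ?thesis unfolding degree_def .
qed

text \<open>The passage between a list and a set of paths needs the list to be repetition-free. This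
  matches the condition on lengths 1, since only one-edge paths could be repeated.\<close>

lemma theta_graph_iff_bundle:
  "theta_graph t G \<longleftrightarrow> t \<ge> 3 \<and> (\<exists>u v S. path_bundle u v S \<and> card S = t \<and> G = bundle_graph S)"
proof
  assume "theta_graph t G"
  then obtain ls u v Ps where ls: "length ls = t" "t \<ge> 3" "\<forall>l\<in>set ls. l \<ge> 1" "count_list ls 1 \<le> 1"
    and Ps: "length Ps = length ls"
    "\<And>i. i < length ls \<Longrightarrow> distinct (Ps ! i) \<and> length (Ps ! i) = ls ! i + 1 \<and>
       hd (Ps ! i) = u \<and> last (Ps ! i) = v"
    "\<And>i j. i < length ls \<Longrightarrow> j < length ls \<Longrightarrow> i \<noteq> j \<Longrightarrow> set (Ps ! i) \<inter> set (Ps ! j) = {u, v}"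
    and G: "G = (\<Union>P\<in>set Ps. set P, \<Union>P\<in>set Ps. path_edges P)"
    unfolding theta_graph_def theta_def path_of_eq by auto
  have len: "length (Ps ! i) \<ge> 2" if "i < length ls" for i
    using Ps(2)[OF that] ls(3) nth_mem[OF that] by auto
  have "0 < length ls" using ls by auto
  then have "u \<noteq> v"
    using Ps(2)[of 0] len[of 0] by (cases "Ps ! 0"; cases "tl (Ps ! 0)") (auto split: if_splits)
  have "distinct Ps"
  proof (rule ccontr)
    assume "\<not> distinct Ps"
    then obtain i j where ij: "i < length ls" "j < length ls" "i \<noteq> j" "Ps ! i = Ps ! j"
      using Ps(1) by (auto simp: distinct_conv_nth)
    \<comment> \<open>Equal paths at different positions meet exactly in \<open>{u, v}\<close>,
      hence have no inner vertices and length 1.\<close>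
    then have "set (Ps ! i) = {u, v}" using Ps(3)[of i j] by auto
    then have "length (Ps ! i) = 2" using Ps(2)[OF ij(1)] \<open>u \<noteq> v\<close> distinct_card[of "Ps ! i"] by auto
    then have "ls ! i = 1" "ls ! j = 1" using Ps(2)[OF ij(1)] Ps(2)[OF ij(2)] ij(4) by auto
    then have "{i, j} \<subseteq> {k. k < length ls \<and> 1 = ls ! k}" using ij by auto
    then have "card {i, j} \<le> count_list ls 1"
      unfolding count_list_eq_length_filter length_filter_conv_card by (intro card_mono) auto
    then show False using ls(4) ij(3) by auto
  qed
  then have "card (set Ps) = t" using Ps(1) ls(1) by (simp add: distinct_card)
  moreover have "path_bundle u v (set Ps)"
  proof -
    have "P \<noteq> [] \<and> distinct P \<and> hd P = u \<and> last P = v" if "P \<in> set Ps" for P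
      using that Ps(1,2) len by (force simp: in_set_conv_nth)
    moreover have "set P \<inter> set P' = {u, v}" if "P \<in> set Ps" "P' \<in> set Ps" "P \<noteq> P'" for P P'
      using that Ps(1) Ps(3) by (metis in_set_conv_nth)
    ultimately show ?thesis using \<open>u \<noteq> v\<close> unfolding path_bundle_def by auto
  qed
  ultimately show "t \<ge> 3 \<and> (\<exists>u v S. path_bundle u v S \<and> card S = t \<and> G = bundle_graph S)"
    using G ls(2) by (auto simp: bundle_graph_def)
next
  assume "t \<ge> 3 \<and> (\<exists>u v S. path_bundle u v S \<and> card S = t \<and> G = bundle_graph S)"
  then obtain u v S where t: "t \<ge> 3" and S: "path_bundle u v S" "card S = t" "G = bundle_graph S" by auto
  obtain Ps where Ps: "set Ps = S" "distinct Ps"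
    using S(1) finite_distinct_list unfolding path_bundle_def by metis
  define ls where "ls = map (\<lambda>P. length P - 1) Ps"
  have l: "length ls = length Ps" "length Ps = t" using Ps S(2) distinct_card[OF Ps(2)] by (auto simp: ls_def)
  have P: "distinct (Ps ! i)" "length (Ps ! i) = ls ! i + 1" "hd (Ps ! i) = u" "last (Ps ! i) = v"
    "length (Ps ! i) \<ge> 2" if "i < length Ps" for i
  proof -
    have "Ps ! i \<in> S" using that Ps(1) by auto
    then show "distinct (Ps ! i)" "hd (Ps ! i) = u" "last (Ps ! i) = v" "length (Ps ! i) \<ge> 2"
      using bundle_path[OF S(1)] by auto
    then show "length (Ps ! i) = ls ! i + 1" using that by (simp add: ls_def)
  qed
  have inter: "set (Ps ! i) \<inter> set (Ps ! j) = {u, v}" if "i < length Ps" "j < length Ps" "i \<noteq> j" for i j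
    using that bundle_inter[OF S(1), of "Ps ! i" "Ps ! j"] Ps by (auto simp: nth_eq_iff_index_eq)
  have "count_list ls 1 \<le> 1"
  proof -
    have "i = j" if "i < length ls" "ls ! i = 1" "j < length ls" "ls ! j = 1" for i j
    proof -
      \<comment> \<open>A path of length 1 is determined by its ends, so it fills one position
        only.\<close>
      have "Ps ! k = [u, v]" if "k < length Ps" "ls ! k = 1" for k
        using P[OF that(1)] that(2) by (cases "Ps ! k"; cases "tl (Ps ! k)") auto
      then have "Ps ! i = Ps ! j" using that l by simp
      then show ?thesis using Ps(2) that l by (simp add: nth_eq_iff_index_eq)
    qed
    then have "card {k. k < length ls \<and> 1 = ls ! k} \<le> 1"
      by (subst card_le_Suc0_iff_eq[unfolded One_nat_def[symmetric]]) auto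
    then show ?thesis unfolding count_list_eq_length_filter length_filter_conv_card .
  qed
  moreover have "\<forall>l\<in>set ls. l \<ge> 1"
  proof
    fix l assume "l \<in> set ls"
    then obtain p where "p \<in> S" "l = length p - 1" using Ps(1) by (auto simp: ls_def)
    then show "l \<ge> 1" using bundle_path(6)[OF S(1), of p] by auto
  qed
  moreover have "G = (\<Union>P\<in>set Ps. verts (path_of P), \<Union>P\<in>set Ps. edges (path_of P))"
    using S(3) Ps(1) by (simp add: bundle_graph_def path_of_eq)
  ultimately have "theta ls G"
    unfolding theta_def using l t P(1-4) inter by (intro conjI exI[of _ u] exI[of _ v] exI[of _ Ps]) auto
  then show "theta_graph t G" unfolding theta_graph_def using l by auto
qed

section \<open>Upper bounds on the number of cycles\<close>

text \<open>For finite \<open>E\<close> this is the cycle space over GF(2), with symmetric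
  difference as addition.\<close>

definition even_sets :: "'a set set \<Rightarrow> 'a set set set" where
  "even_sets E = {D. D \<subseteq> E \<and> (\<forall>v. even (card {f \<in> D. v \<in> f}))}"

lemma even_card_sym_diff:
  assumes "finite A" "finite B" "even (card A)" "even (card B)"
  shows "even (card (sym_diff A B))"
proof -
  have "card (sym_diff A B) = card (A - B) + card (B - A)"
    using assms by (intro card_Un_disjoint) auto
  moreover have "card A = card (A - B) + card (A \<inter> B)"
    using assms(1) by (subst card_Un_disjoint[symmetric]) (auto intro: arg_cong[where f = card])
  moreover have "card B = card (B - A) + card (A \<inter> B)"
    using assms(2) by (subst card_Un_disjoint[symmetric]) (auto intro: arg_cong[where f = card])
  ultimately show ?thesis using assms(3,4) by presburger
qed

lemma even_sets_sym_diff: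
  assumes "finite E" and "D \<in> even_sets E" "D' \<in> even_sets E"
  shows "sym_diff D D' \<in> even_sets E"
proof -
  have sub: "D \<subseteq> E" "D' \<subseteq> E" using assms unfolding even_sets_def by auto
  then have fin: "finite D" "finite D'" using assms(1) finite_subset by auto
  have "even (card {f \<in> sym_diff D D'. v \<in> f})" for v
  proof -
    have "{f \<in> sym_diff D D'. v \<in> f} = sym_diff {f \<in> D. v \<in> f} {f \<in> D'. v \<in> f}" by auto
    then show ?thesis
      using even_card_sym_diff[of "{f \<in> D. v \<in> f}" "{f \<in> D'. v \<in> f}"] fin assms(2,3)
      unfolding even_sets_def by auto
  qed
  then show ?thesis using sub unfolding even_sets_def by auto
qed

lemma finite_even_sets: "finite E \<Longrightarrow> finite (even_sets E)"
  unfolding even_sets_def by simp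

text \<open>At an inner vertex of \<open>P\<close> only the two path edges can belong to
  \<open>D\<close>, and evenness forces both or none. The choice therefore propagates along the
  whole path.\<close>

lemma even_set_path:
  assumes "distinct P" and "\<forall>v. even (card {f \<in> D. v \<in> f})"
    and "\<And>w f. w \<in> set P - {hd P, last P} \<Longrightarrow> f \<in> D \<Longrightarrow> w \<in> f \<Longrightarrow> f \<in> path_edges P"
  shows "path_edges P \<subseteq> D \<or> path_edges P \<inter> D = {}"
  using assms
proof (induction P rule: path_edges.induct)
  case (3 x y zs)
  show ?case
  proof (cases zs)
    case (Cons z zs')
    have "path_edges (y # zs) \<subseteq> D \<or> path_edges (y # zs) \<inter> D = {}"
    proof (rule "3.IH")
      fix w f assume w: "w \<in> set (y # zs) - {hd (y # zs), last (y # zs)}" "f \<in> D" "w \<in> f"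
      then have "w \<noteq> x" "w \<noteq> y" using "3.prems"(1) by auto
      moreover have "f \<in> path_edges (x # y # zs)"
        using w "3.prems"(1) by (intro "3.prems"(3)[of w]) auto
      ultimately show "f \<in> path_edges (y # zs)" using w(3) by auto
    qed (use "3.prems" in auto)
    moreover have "{x, y} \<in> D \<longleftrightarrow> {y, z} \<in> D"
    proof -
      have ne: "{x, y} \<noteq> {y, z}" using "3.prems"(1) Cons by (auto simp: doubleton_eq_iff)
      have "f = {x, y} \<or> f = {y, z}" if "f \<in> D" "y \<in> f" for f
      proof -
        have "y \<noteq> last (x # y # zs)" using "3.prems"(1) Cons by auto
        then have "f \<in> path_edges (x # y # zs)"
          using that "3.prems"(1) by (intro "3.prems"(3)[of y]) auto
        moreover have "f \<notin> path_edges (z # zs')"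
          using that(2) "3.prems"(1) Cons path_edges_subset[of f "z # zs'"] by auto
        ultimately show ?thesis using Cons by auto
      qed
      \<comment> \<open>The degree of \<open>y\<close> in \<open>D\<close> counts only these two
        edges, so they are in \<open>D\<close> together or not at all.\<close>
      then have "{f \<in> D. y \<in> f} = D \<inter> {{x, y}, {y, z}}" by auto
      then have "even (card (D \<inter> {{x, y}, {y, z}}))" using "3.prems"(2) by metis
      then show ?thesis using ne
        by (cases "{x, y} \<in> D"; cases "{y, z} \<in> D") auto
    qed
    ultimately show ?thesis using Cons by auto
  qed auto
qed auto

text \<open>An even subset contains all edges of the path or none; all of them would give the first
  vertex degree 1.\<close>

lemma even_sets_path:
  assumes "distinct P"
  shows "even_sets (path_edges P) \<subseteq> {{}}"
proof
  fix D assume D: "D \<in> even_sets (path_edges P)"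
  then consider "path_edges P \<subseteq> D" "path_edges P \<noteq> {}" | "path_edges P \<inter> D = {}"
    using even_set_path[OF assms, of D] unfolding even_sets_def by blast
  then show "D \<in> {{}}"
  proof cases
    case 1
    then have "D = path_edges P" "length P \<ge> 2"
      using D unfolding even_sets_def path_edges_empty_iff by auto
    then have "{f \<in> D. hd P \<in> f} = {{hd P, hd (tl P)}}"
      using hd_edge_unique[OF assms] by (cases P; cases "tl P") auto
    then have "card {f \<in> D. hd P \<in> f} = 1" by simp
    moreover have "even (card {f \<in> D. hd P \<in> f})" using D unfolding even_sets_def by blast
    ultimately show ?thesis by simp
  next
    case 2
    then show ?thesis using D unfolding even_sets_def by auto
  qed
qed

text \<open>An ear raises the dimension of the cycle space by at most one.\<close>

lemma even_sets_ear:
  assumes "finite E" and "distinct Q"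
    and int: "\<And>w f. w \<in> set Q - {hd Q, last Q} \<Longrightarrow> f \<in> E \<Longrightarrow> w \<notin> f"
  shows "card (even_sets (E \<union> path_edges Q)) \<le> 2 * card (even_sets E)"
proof -
  let ?E = "E \<union> path_edges Q"
  have alt: "path_edges Q \<subseteq> D \<or> D \<in> even_sets E" if "D \<in> even_sets ?E" for D
  proof -
    have D: "D \<subseteq> ?E" "\<forall>v. even (card {f \<in> D. v \<in> f})" using that unfolding even_sets_def by auto
    have "path_edges Q \<subseteq> D \<or> path_edges Q \<inter> D = {}"
    proof (rule even_set_path[OF assms(2) D(2)])
      show "f \<in> path_edges Q" if "w \<in> set Q - {hd Q, last Q}" "f \<in> D" "w \<in> f" for w f
        using int[OF that(1)] that(2,3) D(1) by blast
    qed
    then show ?thesis using that unfolding even_sets_def by auto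
  qed
  have fin: "finite (even_sets E)" "finite ?E" using assms(1) finite_even_sets by auto
  show ?thesis
  proof (cases "\<exists>D0\<in>even_sets ?E. path_edges Q \<subseteq> D0")
    case True
    then obtain D0 where D0: "D0 \<in> even_sets ?E" "path_edges Q \<subseteq> D0" by auto
    \<comment> \<open>Members that avoid \<open>Q\<close> are even sets of \<open>E\<close>; members
      that contain \<open>Q\<close> become so after adding the fixed \<open>D0\<close>, which
      cancels \<open>Q\<close>.\<close>
    have "even_sets ?E \<subseteq> even_sets E \<union> (\<lambda>X. sym_diff X D0) ` even_sets E"
    proof
      fix D assume D: "D \<in> even_sets ?E"
      show "D \<in> even_sets E \<union> (\<lambda>X. sym_diff X D0) ` even_sets E"
      proof (cases "path_edges Q \<subseteq> D")
        case True
        have "sym_diff D D0 \<in> even_sets ?E" using even_sets_sym_diff[OF fin(2) D D0(1)] .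
        moreover have "sym_diff D D0 \<subseteq> E" using True D D0 unfolding even_sets_def by auto
        ultimately have "sym_diff D D0 \<in> even_sets E" unfolding even_sets_def by auto
        moreover have "D = sym_diff (sym_diff D D0) D0" by auto
        ultimately show ?thesis by blast
      next
        case False
        then show ?thesis using alt[OF D] by auto
      qed
    qed
    then have "card (even_sets ?E) \<le> card (even_sets E \<union> (\<lambda>X. sym_diff X D0) ` even_sets E)"
      using fin by (intro card_mono) auto
    also have "\<dots> \<le> card (even_sets E) + card ((\<lambda>X. sym_diff X D0) ` even_sets E)"
      by (rule card_Un_le)
    also have "\<dots> \<le> card (even_sets E) + card (even_sets E)"
      using card_image_le[OF fin(1)] by (intro add_left_mono)
    finally show ?thesis by simp
  next
    case False
    then have "even_sets ?E \<subseteq> even_sets E" using alt by auto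
    then have "card (even_sets ?E) \<le> card (even_sets E)" using fin by (intro card_mono) auto
    then show ?thesis by simp
  qed
qed

text \<open>The first path contributes dimension 0, and each further path is an ear.\<close>

lemma even_sets_bundle:
  assumes "path_bundle u v S" and "S \<noteq> {}"
  shows "card (even_sets (edges (bundle_graph S))) \<le> 2 ^ (card S - 1)"
proof -
  have "finite S" using assms(1) unfolding path_bundle_def by simp
  then show ?thesis using assms(2,1)
  proof (induction S rule: finite_ne_induct)
    case (singleton P)
    then have "card (even_sets (path_edges P)) \<le> card {{} :: 'a set set}"
      using even_sets_path[of P] by (intro card_mono) (auto simp: path_bundle_def)
    then show ?case by simp
  next
    case (insert P S)
    have S: "path_bundle u v S" using insert.prems by (rule bundle_subset) auto
    have P: "distinct P" "hd P = u" "last P = v" using bundle_path[OF insert.prems, of P] by auto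
    let ?E = "edges (bundle_graph S)"
    have "card (even_sets (?E \<union> path_edges P)) \<le> 2 * card (even_sets ?E)"
    proof (rule even_sets_ear)
      show "finite ?E" using finite_edges[OF simple_bundle_graph[OF S]] .
      fix w f assume w: "w \<in> set P - {hd P, last P}" "f \<in> ?E"
      then obtain P' where P': "P' \<in> S" "f \<in> path_edges P'" by auto
      then have "P \<noteq> P'" using insert.hyps by auto
      then have "set P \<inter> set P' = {u, v}" using bundle_inter[OF insert.prems] P' by auto
      then show "w \<notin> f" using w(1) path_edges_subset[OF P'(2)] P by blast
    qed (fact P)
    also have "\<dots> \<le> 2 * 2 ^ (card S - 1)" using insert.IH[OF S] by simp
    \<comment> \<open>The old \<open>S\<close> is nonempty, so the subtraction in
      \<open>card S - 1\<close> does not truncate.\<close>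
    also have "\<dots> = 2 ^ (card (insert P S) - 1)"
      using insert.hyps by (cases "card S") auto
    finally show ?case by (simp add: Un_commute)
  qed
qed

text \<open>Adding a fixed member that contains \<open>e\<close> maps the members with
  \<open>e\<close> injectively to those without.\<close>

lemma even_sets_through_edge:
  assumes "finite E"
  shows "2 * card {D \<in> even_sets E. e \<in> D} \<le> card (even_sets E)"
proof (cases "{D \<in> even_sets E. e \<in> D} = {}")
  case False
  then obtain D1 where D1: "D1 \<in> even_sets E" "e \<in> D1" by auto
  let ?X = "{D \<in> even_sets E. e \<in> D}" and ?Y = "{D \<in> even_sets E. e \<notin> D}"
  have fin: "finite (even_sets E)" using finite_even_sets[OF assms] .
  have "inj_on (\<lambda>D. sym_diff D D1) ?X"
    by (rule inj_onI) blast
  moreover have "(\<lambda>D. sym_diff D D1) ` ?X \<subseteq> ?Y"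
    using even_sets_sym_diff[OF assms _ D1(1)] D1(2) by auto
  ultimately have "card ?X \<le> card ?Y" using fin by (intro card_inj_on_le[of "\<lambda>D. sym_diff D D1"]) auto
  moreover have "card (even_sets E) = card ?X + card ?Y"
    using fin by (subst card_Un_disjoint[symmetric]) (auto intro: arg_cong[where f = card])
  ultimately show ?thesis by simp
qed (metis card.empty mult_0_right zero_le)

section \<open>Cycles as elements of the cycle space\<close>

lemma cycle_even:
  assumes "cycle_graph C"
  shows "even (card {f \<in> edges C. v \<in> f})"
proof (cases "v \<in> verts C")
  case True
  then show ?thesis using cycle_degree[OF assms] by simp
next
  case False
  then have "{f \<in> edges C. v \<in> f} = {}" using verts_cycle[OF assms] by auto
  then show ?thesis by (metis card.empty even_zero)
qed

lemma cycle_eqI: "cycle_graph C \<Longrightarrow> cycle_graph C' \<Longrightarrow> edges C = edges C' \<Longrightarrow> C = C'"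
  using verts_cycle[of C] verts_cycle[of C'] by (intro prod_eqI) auto

lemma card_cycles_through_le_even_sets:
  assumes "simple_graph G"
  shows "2 * card (cycles_through G e) \<le> card (even_sets (edges G))"
proof -
  have "inj_on edges (cycles_through G e)" by (rule inj_onI) (blast intro: cycle_eqI)
  moreover have "edges ` cycles_through G e \<subseteq> {D \<in> even_sets (edges G). e \<in> D}"
    using cycle_even unfolding even_sets_def subgraph_def by auto
  moreover have "finite {D \<in> even_sets (edges G). e \<in> D}"
    using finite_even_sets[OF finite_edges[OF assms]] by simp
  ultimately have "card (cycles_through G e) \<le> card {D \<in> even_sets (edges G). e \<in> D}"
    by (rule card_inj_on_le)
  then show ?thesis using even_sets_through_edge[OF finite_edges[OF assms], of e] by linarith
qed

text \<open>The three paths of \<open>F\<close> give at most 4 even sets, the ear doubles this to 8,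
  and cycles through \<open>e\<close> account for at most half.\<close>

lemma theta3'_cycles_upper:
  assumes "theta3'_graph G"
  shows "card (cycles_through G e) \<le> 4"
proof -
  obtain F p q r Q where F: "theta [p, q, r] F" and Q: "ear G F Q" and G: "G = graph_union F (path_of Q)"
    using assms unfolding theta3'_graph_def by auto
  have "theta_graph 3 F" unfolding theta_graph_def using F by (intro exI[of _ "[p, q, r]"]) auto
  then obtain u v S where S: "path_bundle u v S" "card S = 3" "F = bundle_graph S"
    unfolding theta_graph_iff_bundle by auto
  have "S \<noteq> {}" using S(2) by auto
  have sF: "simple_graph F" using S simple_bundle_graph by auto
  have EG: "edges G = edges F \<union> path_edges Q" using G by (simp add: graph_union_def path_of_eq)
  have "card (even_sets (edges G)) \<le> 2 * card (even_sets (edges F))"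
    unfolding EG
  proof (rule even_sets_ear)
    show "finite (edges F)" using finite_edges[OF sF] .
    show "distinct Q" using Q unfolding ear_def path_in_iff by auto
    show "w \<notin> f" if "w \<in> set Q - {hd Q, last Q}" "f \<in> edges F" for w f
      using that Q sF unfolding ear_def simple_graph_def by blast
  qed
  also have "\<dots> \<le> 2 * 2 ^ (card S - 1)" using even_sets_bundle[OF S(1) \<open>S \<noteq> {}\<close>] S(3) by simp
  finally have "card (even_sets (edges G)) \<le> 8" using S(2) by simp
  moreover have "simple_graph G"
    using sF Q unfolding G ear_def path_in_iff graph_union_def path_of_eq
    by (auto simp: simple_graph_def dest: path_edges_subset card_path_edge)
  ultimately show ?thesis using card_cycles_through_le_even_sets[of G e] by linarith
qed

text \<open>For more than three paths the cycle space bound is too weak. Instead, a cycle contains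
  each path entirely or not at all; having degree 2 at \<open>u\<close>, it consists of exactly two
  paths, one of which is the path through \<open>e\<close>.\<close>

lemma bundle_cycles_upper:
  assumes S: "path_bundle u v S" and e: "e \<in> edges (bundle_graph S)"
  shows "card (cycles_through (bundle_graph S) e) \<le> card S - 1"
proof -
  obtain P where P: "P \<in> S" "e \<in> path_edges P" using e by auto
  have "cycles_through (bundle_graph S) e \<subseteq> (\<lambda>P'. bundle_graph {P, P'}) ` (S - {P})"
  proof
    fix C assume "C \<in> cycles_through (bundle_graph S) e"
    then have C: "cycle_graph C" "edges C \<subseteq> (\<Union>P\<in>S. path_edges P)" "e \<in> edges C"
      unfolding subgraph_def by auto
    have all: "path_edges R \<subseteq> edges C \<or> path_edges R \<inter> edges C = {}" if R: "R \<in> S" for R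
    proof (rule even_set_path)
      show "distinct R" "\<forall>v. even (card {f \<in> edges C. v \<in> f})"
        using bundle_path(1)[OF S R] cycle_even[OF C(1)] by auto
      fix w f assume w: "w \<in> set R - {hd R, last R}" "f \<in> edges C" "w \<in> f"
      then obtain R' where R': "R' \<in> S" "f \<in> path_edges R'" using C(2) by auto
      have "w \<in> set R'" using path_edges_subset[OF R'(2)] w(3) by auto
      then have "R' = R" using bundle_inter[OF S R R'(1)] w(1) bundle_path(2,3)[OF S R] by auto
      then show "f \<in> path_edges R" using R' by simp
    qed
    \<comment> \<open>The edge of \<open>R\<close> at \<open>u\<close>; different paths have
      different such edges, so they count the degree of \<open>u\<close>.\<close>
    define first where "first R = {u, hd (tl R)}" for R
    have first: "first R \<in> path_edges R" "u \<in> first R" if "R \<in> S" for R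
      using bundle_path(2,6)[OF S that] unfolding first_def by (cases R; cases "tl R"; auto)+
    have PC: "path_edges P \<subseteq> edges C" using all[OF P(1)] P(2) C(3) by auto
    then have fP: "first P \<in> edges C" using first P by auto
    then have "u \<in> verts C" using first(2)[OF P(1)] verts_cycle[OF C(1)] by auto
    then have deg: "card {f \<in> edges C. u \<in> f} = 2" using cycle_degree[OF C(1)] by simp
    have "{f \<in> edges C. u \<in> f} \<noteq> {first P}"
    proof
      assume "{f \<in> edges C. u \<in> f} = {first P}"
      then show False using deg card_1_singleton_iff by (metis Suc_1 n_not_Suc_n One_nat_def)
    qed
    \<comment> \<open>The second edge of \<open>C\<close> at \<open>u\<close> identifies the other
      path \<open>R\<close>.\<close>
    then obtain f where f: "f \<in> edges C" "u \<in> f" "f \<noteq> first P"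
      using fP first(2)[OF P(1)] by blast
    then obtain R where R: "R \<in> S" "f \<in> path_edges R" using C(2) by auto
    have "R \<noteq> P"
      using hd_edge_unique[of P f] bundle_path(1,2)[OF S P(1)] R f unfolding first_def by auto
    have RC: "path_edges R \<subseteq> edges C" using all[OF R(1)] R(2) f(1) by auto
    \<comment> \<open>A third path inside \<open>C\<close> would give \<open>u\<close> degree
      3.\<close>
    have "T = P \<or> T = R" if T: "T \<in> S" "path_edges T \<inter> edges C \<noteq> {}" for T
    proof (rule ccontr)
      assume ne: "\<not> (T = P \<or> T = R)"
      have TC: "path_edges T \<subseteq> edges C" using all[OF T(1)] T(2) by auto
      have "first X \<noteq> first Y" if "X \<in> S" "Y \<in> S" "X \<noteq> Y" for X Y
        using bundle_edges_disjoint[OF S that] first(1)[OF that(1)] first(1)[OF that(2)] by auto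
      then have "first T \<noteq> first P" "first T \<noteq> first R" "first P \<noteq> first R"
        using P(1) R(1) T(1) ne \<open>R \<noteq> P\<close> by metis+
      then have "card {first T, first P, first R} = 3" by simp
      moreover have "{first T, first P, first R} \<subseteq> {f \<in> edges C. u \<in> f}"
        using TC PC RC first[OF P(1)] first[OF R(1)] first[OF T(1)] by auto
      moreover have "finite {f \<in> edges C. u \<in> f}" by (rule card_ge_0_finite) (simp add: deg)
      ultimately have "3 \<le> card {f \<in> edges C. u \<in> f}" by (metis card_mono)
      then show False using deg by simp
    qed
    note only = this
    have E: "edges C = path_edges P \<union> path_edges R"
    proof
      show "edges C \<subseteq> path_edges P \<union> path_edges R"
      proof
        fix g assume g: "g \<in> edges C"
        then obtain T where "T \<in> S" "g \<in> path_edges T" using C(2) by auto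
        then show "g \<in> path_edges P \<union> path_edges R" using only[of T] g by auto
      qed
    qed (use PC RC in auto)
    have "cycle_graph (bundle_graph {P, R})"
      using bundle_cycle[of u v P R] bundle_subset[OF S, of "{P, R}"] P R \<open>R \<noteq> P\<close> by auto
    then have "C = bundle_graph {P, R}" using cycle_eqI[OF C(1)] E by auto
    then show "C \<in> (\<lambda>P'. bundle_graph {P, P'}) ` (S - {P})" using R(1) \<open>R \<noteq> P\<close> by blast
  qed
  moreover have fin: "finite S" using S unfolding path_bundle_def by simp
  ultimately have "card (cycles_through (bundle_graph S) e) \<le> card ((\<lambda>P'. bundle_graph {P, P'}) ` (S - {P}))"
    by (intro card_mono) auto
  also have "\<dots> \<le> card (S - {P})" using fin by (intro card_image_le) auto
  finally show ?thesis using P(1) fin by simp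
qed

section \<open>Structure of biconnected graphs with few cycles\<close>

lemma vertex_has_edge:
  assumes "v \<in> verts G" "card (verts G) \<ge> 2" "\<forall>x\<in>verts G. (v, x) \<in> reach (edges G)"
  obtains w where "{v, w} \<in> edges G"
proof -
  have "verts G \<noteq> {v}" using assms(2) by auto
  then obtain x where "x \<in> verts G" "x \<noteq> v" using assms(1) by auto
  then have "(v, x) \<in> {(a, b). {a, b} \<in> edges G}\<^sup>*" "x \<noteq> v" using assms(3) unfolding reach_def by auto
  then show thesis using that by (cases rule: converse_rtranclE) auto
qed

text \<open>An end of \<open>Q\<close> outside \<open>{u, v}\<close> has degree at most 2 in the
  bundle, so the ends of \<open>Q\<close> cannot both have degree 3.\<close>

lemma theta3'_graph_if_crossing_ear:
  assumes S: "path_bundle u v S" "card S = 3" and Q: "attached (bundle_graph S) Q"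
    and ends: "{hd Q, last Q} \<noteq> {u, v}"
  shows "theta3'_graph (graph_union (bundle_graph S) (path_of Q))"
proof -
  let ?F = "bundle_graph S"
  let ?H = "graph_union ?F (path_of Q)"
  have "theta_graph 3 ?F" using S unfolding theta_graph_iff_bundle by auto
  then obtain ls where "length ls = 3" "theta ls ?F" unfolding theta_graph_def by auto
  then obtain p q r where t: "theta [p, q, r] ?F"
    by (auto simp: length_Suc_conv numeral_3_eq_3)
  have Q': "Q \<noteq> []" "distinct Q" "hd Q \<in> verts ?F" "last Q \<in> verts ?F"
    using Q unfolding attached_def by auto
  have "hd Q \<noteq> last Q" using Q unfolding attached_def by (cases Q; cases "tl Q") auto
  then have "hd Q \<notin> {u, v} \<or> last Q \<notin> {u, v}" using ends by auto
  then have "degree ?F (hd Q) \<le> 2 \<or> degree ?F (last Q) \<le> 2"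
    using bundle_inner_degree[OF S(1)] Q' by blast
  then have "\<not> (degree ?F (hd Q) = 3 \<and> degree ?F (last Q) = 3)" by auto
  moreover have "ear ?H ?F Q"
    unfolding ear_def
  proof (intro conjI)
    show "subgraph ?F ?H" using simple_bundle_graph[OF S(1)]
      by (auto simp: subgraph_def graph_union_def)
    show "path_in ?H Q" using Q' by (auto simp: path_in_iff graph_union_def path_of_eq)
    show "edges (path_of Q) \<inter> edges ?F = {}" using Q unfolding attached_def path_of_eq by auto
  qed (use Q in \<open>auto simp: attached_def\<close>)
  ultimately show ?thesis unfolding theta3'_graph_def using t by blast
qed

lemma subgraph_graph_union_path:
  assumes "subgraph F B" "path_in B Q"
  shows "subgraph (graph_union F (path_of Q)) B"
  using assms unfolding subgraph_def path_in_iff simple_graph_def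
  by (auto simp: graph_union_def path_of_eq dest: path_edges_subset card_path_edge)

text \<open>One step of the ear decomposition: the next ear either joins \<open>u\<close> and
  \<open>v\<close> and becomes a further path of the bundle, or it crosses.\<close>

lemma bundle_extend:
  assumes B: "biconn B" and S: "path_bundle u v S" "S \<noteq> {}" and sub: "subgraph (bundle_graph S) B"
    and ne: "bundle_graph S \<noteq> B"
  obtains (parallel) S' where "path_bundle u v S'" "card S' = Suc (card S)" "subgraph (bundle_graph S') B"
  | (crossing) Q where "attached (bundle_graph S) Q" "path_in B Q" "{hd Q, last Q} \<noteq> {u, v}"
proof -
  obtain P where "P \<in> S" using S(2) by auto
  then have uv: "u \<in> verts (bundle_graph S)" "v \<in> verts (bundle_graph S)" "u \<noteq> v"
    using bundle_path[OF S(1)] by auto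
  obtain Q where Q: "attached (bundle_graph S) Q" "path_in B Q"
    using ear_exists[OF B sub ne uv] by metis
  have *: thesis if W: "attached (bundle_graph S) W" "path_in B W" "hd W = u" "last W = v" for W
  proof (rule parallel)
    show "path_bundle u v (insert W S)" using bundle_insert(1)[OF S W(1,3,4)] .
    show "card (insert W S) = Suc (card S)"
      using bundle_insert(2)[OF S W(1,3,4)] S(1) unfolding path_bundle_def by simp
    show "subgraph (bundle_graph (insert W S)) B"
      unfolding bundle_graph_insert using sub W(2) by (rule subgraph_graph_union_path)
  qed
  consider "hd Q = u" "last Q = v" | "hd Q = v" "last Q = u" | "{hd Q, last Q} \<noteq> {u, v}"
    by (auto simp: doubleton_eq_iff)
  then show thesis
  proof cases
    case 1
    then show thesis using * Q by blast
  next
    case 2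
    then show thesis
      using *[of "rev Q"] Q by (auto simp: attached_rev hd_rev last_rev path_in_iff)
  qed (use Q crossing in blast)
qed

text \<open>A cycle is extended by ears to bundles of 3, 4 and 5 paths until \<open>B\<close> is
  reached or an ear crosses. Each stage has an edge with a known number of cycles, and
  \<open>card_cycles_strict_mono\<close> adds one if \<open>B\<close> is still larger.\<close>

lemma biconn_structure:
  assumes B: "biconn B" "card (verts B) \<ge> 3"
  obtains (cycle) "cycle_graph B"
  | (theta) t e where "t \<in> {3, 4, 5}" "theta_graph t B" "e \<in> edges B" "card (cycles_through B e) \<ge> t - 1"
  | (theta3') e where "theta3'_graph B" "e \<in> edges B" "card (cycles_through B e) \<ge> 4"
  | (many) e where "e \<in> edges B" "card (cycles_through B e) \<ge> 5"
proof -
  have bundle_edge: "\<exists>e\<in>edges (bundle_graph S). card S - 1 \<le> card (cycles_through (bundle_graph S) e)"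
    if S: "path_bundle u v S" "S \<noteq> {}" for u v S
  proof -
    obtain P where P: "P \<in> S" using S(2) by auto
    then obtain e where "e \<in> path_edges P"
      using bundle_path(6)[OF S(1) P] path_edges_empty_iff[of P] by fastforce
    then show ?thesis using bundle_cycles_lower[OF S(1) P] P by auto
  qed
  have exact: thesis if S: "path_bundle u v S" "card S \<in> {3, 4, 5}" "bundle_graph S = B" for u v S
  proof -
    have "S \<noteq> {}" using S(2) by auto
    moreover have "theta_graph (card S) B" using S unfolding theta_graph_iff_bundle by auto
    ultimately show thesis using bundle_edge[OF S(1)] theta[of "card S"] S(2,3) by blast
  qed
  have sB: "simple_graph B" using B(1) unfolding biconn_iff by simp
  obtain a where a: "a \<in> verts B" using B(1) unfolding biconn_iff by auto
  then obtain b where e: "{a, b} \<in> edges B"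
    using vertex_has_edge[of a B] B unfolding biconn_iff by auto
  obtain C where C: "cycle_graph C" "subgraph C B" using cycle_through_edge[OF B e] by metis
  show thesis
  proof (cases "C = B")
    case True
    then show thesis using C(1) cycle by simp
  next
    case C_ne: False
    have "card (verts C) \<ge> 3" using card_verts_cycle[OF C(1)] .
    then obtain s t where "s \<in> verts C" "t \<in> verts C" "s \<noteq> t"
      using card_le_Suc0_iff_eq[OF card_ge_0_finite, of "verts C"] by fastforce
    then obtain Q where Q: "attached C Q" "path_in B Q" using ear_exists[OF B(1) C(2) C_ne] by metis
    obtain R R' where R: "R \<noteq> R'" "Q \<noteq> R" "Q \<noteq> R'" "path_bundle (hd Q) (last Q) {Q, R, R'}"
      "C = bundle_graph {R, R'}"
      using cycle_ear_bundle[OF C(1) Q(1)] by metis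
    define u v S3 where "u = hd Q" and "v = last Q" and "S3 = {Q, R, R'}"
    have S3: "path_bundle u v S3" "card S3 = 3" "S3 \<noteq> {}"
      using R unfolding u_def v_def S3_def by auto
    have "subgraph (bundle_graph S3) B"
      unfolding S3_def bundle_graph_insert[of Q] R(5)[symmetric]
      using C(2) Q(2) by (rule subgraph_graph_union_path)
    note S3 = S3 this
    show thesis
    proof (cases "bundle_graph S3 = B")
      case True
      then show thesis using exact[OF S3(1)] S3(2) by simp
    next
      case S3_ne: False
      from B(1) S3(1,3,4) S3_ne show thesis
      proof (cases rule: bundle_extend)
        case (crossing W)
        let ?H = "graph_union (bundle_graph S3) (path_of W)"
        obtain f where f: "f \<in> edges ?H" "card (cycles_through ?H f) \<ge> 4"
          using four_cycles_crossing_ear[OF S3(1,2) crossing(1,3) refl] by blast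
        have H: "subgraph ?H B" using S3(4) crossing(2) by (rule subgraph_graph_union_path)
        show thesis
        proof (cases "?H = B")
          case True
          have "theta3'_graph ?H" by (rule theta3'_graph_if_crossing_ear[OF S3(1,2) crossing(1,3)])
          then show thesis using f theta3'[of f] unfolding True by blast
        next
          case False
          then have "card (cycles_through B f) \<ge> 5"
            using card_cycles_strict_mono[OF B H False f(1)] f(2) by linarith
          then show thesis using many f(1) H unfolding subgraph_def by blast
        qed
      next
        case (parallel S4)
        then have S4: "path_bundle u v S4" "card S4 = 4" "subgraph (bundle_graph S4) B" "S4 \<noteq> {}"
          using S3(2) by auto
        show thesis
        proof (cases "bundle_graph S4 = B")
          case True
          then show thesis using exact[OF S4(1)] S4(2) by simp
        next
          case S4_ne: False
          from B(1) S4(1,4,3) S4_ne show thesis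
          proof (cases rule: bundle_extend)
            case (crossing W)
            \<comment> \<open>The ends of \<open>W\<close> lie on at most two of the four paths.
              Dropping another path \<open>T\<close> leaves three paths which \<open>W\<close> still
              crosses, hence an edge on four cycles.\<close>
            obtain P1 P2 where P: "P1 \<in> S4" "P2 \<in> S4" "hd W \<in> set P1" "last W \<in> set P2"
              using crossing(1) unfolding attached_def by auto
            have fin: "finite S4" using S4(2) by (metis card.infinite zero_neq_numeral)
            have "card {P1, P2} \<le> 2" by (simp add: card_insert_if)
            then have "\<not> S4 \<subseteq> {P1, P2}" using S4(2) card_mono[of "{P1, P2}" S4] by auto
            then obtain T where T: "T \<in> S4" "T \<noteq> P1" "T \<noteq> P2" by auto
            define S where "S = S4 - {T}"
            have S: "path_bundle u v S" "card S = 3"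
              using bundle_subset[OF S4(1)] T(1) S4(2) fin unfolding S_def by auto
            have att: "attached (bundle_graph S) W"
              using crossing(1) P T unfolding attached_def S_def by auto
            let ?H = "graph_union (bundle_graph S) (path_of W)"
            obtain f where f: "f \<in> edges ?H" "card (cycles_through ?H f) \<ge> 4"
              using four_cycles_crossing_ear[OF S att crossing(3) refl] by blast
            have "subgraph (bundle_graph S) B"
              using S4(3) by (intro subgraph_bundle_graph[OF S(1)]) (auto simp: S_def subgraph_def)
            then have H: "subgraph ?H B" using crossing(2) by (rule subgraph_graph_union_path)
            \<comment> \<open>The edges of \<open>T\<close> are missing, so \<open>B\<close> has a
              fifth cycle through \<open>f\<close>.\<close>
            have "?H \<noteq> B"
            proof -
              obtain g where g: "g \<in> path_edges T"
                using bundle_path(6)[OF S4(1) T(1)] path_edges_empty_iff[of T] by fastforce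
              then have "g \<in> edges B" using S4(3) T(1) unfolding subgraph_def by auto
              moreover have "g \<notin> path_edges W" using crossing(1) g T(1) unfolding attached_def by auto
              moreover have "g \<notin> path_edges X" if "X \<in> S" for X
                using bundle_edges_disjoint[OF S4(1) T(1), of X] that g unfolding S_def by auto
              ultimately show ?thesis by (auto simp: graph_union_def path_of_eq)
            qed
            then have "card (cycles_through B f) \<ge> 5"
              using card_cycles_strict_mono[OF B H _ f(1)] f(2) by linarith
            then show thesis using many f(1) H unfolding subgraph_def by blast
          next
            case (parallel S5)
            then have S5: "path_bundle u v S5" "card S5 = 5" "S5 \<noteq> {}" "subgraph (bundle_graph S5) B"
              using S4(2) by auto
            show thesis
            proof (cases "bundle_graph S5 = B")
              case True
              then show thesis using exact[OF S5(1)] S5(2) by simp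
            next
              case False
              obtain f where f: "f \<in> edges (bundle_graph S5)" "card (cycles_through (bundle_graph S5) f) \<ge> 4"
                using bundle_edge[OF S5(1,3)] S5(2) by auto
              then have "card (cycles_through B f) \<ge> 5"
                using card_cycles_strict_mono[OF B S5(4) False f(1)] by linarith
              then show thesis using many f(1) S5(4) unfolding subgraph_def by blast
            qed
          qed
        qed
      qed
    qed
  qed
qed

section \<open>Blocks\<close>

lemma block_iff:
  "block B G \<longleftrightarrow> subgraph B G \<and> biconn B \<and> (\<forall>H. subgraph H G \<and> biconn H \<and> subgraph B H \<longrightarrow> H = B)"
  unfolding block_def biconn_def by blast

text \<open>Among the finitely many 2-connected subgraphs above \<open>F\<close>, one with the
  largest number of vertices plus edges is maximal under inclusion.\<close>

lemma block_exists:
  assumes G: "simple_graph G" and F: "subgraph F G" "biconn F"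
  obtains B where "block B G" "subgraph F B"
proof -
  let ?K = "{H. subgraph H G \<and> biconn H \<and> subgraph F H}" and ?m = "\<lambda>H. card (verts H) + card (edges H)"
  have fin: "finite ?K" using finite_subgraphs[OF G] by (rule finite_subset[rotated]) auto
  have "F \<in> ?K" using F unfolding subgraph_def by auto
  then have "?m ` ?K \<noteq> {}" by blast
  then have "Max (?m ` ?K) \<in> ?m ` ?K" using fin by (intro Max_in) simp_all
  then obtain B where B: "B \<in> ?K" "?m B = Max (?m ` ?K)" by auto
  have "H = B" if H: "subgraph H G" "biconn H" "subgraph B H" for H
  proof -
    have "H \<in> ?K" using H B(1) subgraph_trans by blast
    then have "?m H \<le> ?m B" using B(2) fin by auto
    moreover have sub: "verts B \<subseteq> verts H" "edges B \<subseteq> edges H" using H(3) unfolding subgraph_def by auto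
    moreover have fH: "finite (verts H)" "finite (edges H)"
      using H(1) finite_edges[of H] unfolding subgraph_def simple_graph_def by auto
    moreover have "card (verts B) \<le> card (verts H)" "card (edges B) \<le> card (edges H)"
      using sub fH by (auto intro: card_mono)
    ultimately have "verts B = verts H" "edges B = edges H"
      using card_seteq[OF fH(1) sub(1)] card_seteq[OF fH(2) sub(2)] by auto
    then show ?thesis by (intro prod_eqI) auto
  qed
  then have "block B G" using B(1) unfolding block_iff by auto
  then show thesis using that B(1) by auto
qed

lemma subgraph_edge_graph:
  assumes "simple_graph G" "{u, v} \<in> edges G"
  shows "u \<noteq> v" and "subgraph ({u, v}, {{u, v}}) G"
  using assms unfolding subgraph_def simple_graph_def by force+

text \<open>A vertex of \<open>G\<close> lies on an edge, and this edge is a larger 2-connected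
  subgraph than the vertex alone. The one-vertex graph has to be excluded: it is its own block, but
  not an edge.\<close>

lemma block_card_verts:
  assumes G: "connected_graph G" "card (verts G) \<ge> 2" and B: "block B G"
  shows "card (verts B) \<ge> 2"
proof (rule ccontr)
  assume small: "\<not> card (verts B) \<ge> 2"
  have sG: "simple_graph G" using G(1) unfolding connected_graph_def by simp
  have reachG: "(x, y) \<in> reach (edges G)" if "x \<in> verts G" "y \<in> verts G" for x y
    using G(1) joined_iff[OF sG] that unfolding connected_graph_def by auto
  have sB: "subgraph B G" "simple_graph B" "verts B \<noteq> {}" "finite (verts B)"
    using B unfolding block_iff biconn_iff simple_graph_def by auto
  then have "card (verts B) = 1"
    using small card_gt_0_iff[of "verts B"] by linarith
  then obtain v where v: "verts B = {v}" by (auto simp: card_1_singleton_iff)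
  then have vG: "v \<in> verts G" using sB(1) unfolding subgraph_def by auto
  obtain w where w: "{v, w} \<in> edges G" using vertex_has_edge[OF vG G(2)] reachG[OF vG] by auto
  have "edges B = {}"
  proof (rule ccontr)
    assume "edges B \<noteq> {}"
    then obtain e where "e \<subseteq> {v}" "card e = 2" using sB(2) v unfolding simple_graph_def by auto
    then show False using card_mono[of "{v}" e] by auto
  qed
  note e = subgraph_edge_graph[OF sG w]
  have "subgraph B ({v, w}, {{v, w}})" using sB(2) v \<open>edges B = {}\<close> unfolding subgraph_def by auto
  then have "({v, w}, {{v, w}}) = B" using B e(2) biconn_edge[OF e(1)] unfolding block_iff by blast
  then show False using v e(1) by auto
qed

text \<open>A common edge gives two common vertices, so the union of block and cycle is 2-connected,
  and maximality of the block absorbs the cycle.\<close>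

lemma cycle_in_block:
  assumes G: "simple_graph G" and B: "block B G" and C: "cycle_graph C" "subgraph C G"
    and e: "e \<in> edges B" "e \<in> edges C"
  shows "subgraph C B"
proof -
  have b: "subgraph B G" "biconn B" "simple_graph B" using B unfolding block_iff biconn_iff by auto
  have "card e = 2" "e \<subseteq> verts B" "e \<subseteq> verts C"
    using b(3) simple_cycle[OF C(1)] e unfolding simple_graph_def by auto
  then obtain x y where xy: "x \<in> verts B \<inter> verts C" "y \<in> verts B \<inter> verts C" "x \<noteq> y"
    by (auto simp: card_2_iff)
  let ?U = "graph_union B C"
  have bU: "biconn ?U" using biconn_union[OF b(2) biconn_cycle[OF C(1)] xy] .
  then have "simple_graph ?U" unfolding biconn_iff by simp
  then have "subgraph ?U G" "subgraph B ?U" "subgraph C ?U"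
    using b(1,3) C(2) unfolding subgraph_def graph_union_def by auto
  then show ?thesis using B bU unfolding block_iff by metis
qed

text \<open>Every edge lies in a block, and that block contains all cycles of \<open>G\<close>
  through the edge; conversely, cycles of a block are cycles of \<open>G\<close>.\<close>

lemma cactus_iff_blocks:
  assumes G: "connected_graph G"
  shows "cactus k G \<longleftrightarrow> (\<forall>B. block B G \<longrightarrow> (\<forall>e\<in>edges B. card (cycles_through B e) \<le> k))"
proof
  have sG: "simple_graph G" using G unfolding connected_graph_def by simp
  {
    assume c: "cactus k G"
    show "\<forall>B. block B G \<longrightarrow> (\<forall>e\<in>edges B. card (cycles_through B e) \<le> k)"
    proof (intro allI impI ballI)
      fix B e assume B: "block B G" "e \<in> edges B"
      then have sub: "subgraph B G" unfolding block_iff by simp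
      then have "card (cycles_through G e) \<le> k" using c B(2) unfolding cactus_def subgraph_def by auto
      then show "card (cycles_through B e) \<le> k" using card_cycles_mono[OF sub sG] order_trans by blast
    qed
  next
    assume b: "\<forall>B. block B G \<longrightarrow> (\<forall>e\<in>edges B. card (cycles_through B e) \<le> k)"
    have "card (cycles_through G e) \<le> k" if e: "e \<in> edges G" for e
    proof -
      obtain u v where uv: "e = {u, v}"
        using e sG unfolding simple_graph_def by (auto simp: card_2_iff)
      note s = subgraph_edge_graph[OF sG e[unfolded uv]]
      obtain B where B: "block B G" "subgraph ({u, v}, {{u, v}}) B"
        using block_exists[OF sG s(2) biconn_edge[OF s(1)]] by metis
      then have eB: "e \<in> edges B" using uv unfolding subgraph_def by auto
      have "simple_graph B" using B(1) unfolding block_iff biconn_iff by simp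
      then have "card (cycles_through G e) \<le> card (cycles_through B e)"
        using cycle_in_block[OF sG B(1) _ _ eB] by (intro card_mono finite_cycles_through) auto
      then show ?thesis using b B(1) eB order_trans by blast
    qed
    then show "cactus k G" using G unfolding cactus_def by auto
  }
qed

section \<open>Cycle counts and classification of the blocks\<close>

lemma edge_graph_cycles: "edge_graph B \<Longrightarrow> cycles_through B e = {}"
proof -
  assume "edge_graph B"
  then have B: "card (verts B) = 2" "finite (verts B)" unfolding edge_graph_def by auto
  have "False" if "cycle_graph C" "subgraph C B" for C
    using card_verts_cycle[OF that(1)] card_mono[OF B(2), of "verts C"] that(2) B(1)
    unfolding subgraph_def by auto
  then show ?thesis by blast
qed

text \<open>A cycle is a bundle of two paths, so the bound for bundles gives 2 - 1.\<close>

lemma cycle_graph_cycles: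
  assumes "cycle_graph B" "e \<in> edges B"
  shows "card (cycles_through B e) \<le> 1"
proof -
  have "card e = 2" "e \<subseteq> verts B"
    using simple_cycle[OF assms(1)] assms(2) unfolding simple_graph_def by auto
  then obtain x y where "x \<in> verts B" "y \<in> verts B" "x \<noteq> y" by (auto simp: card_2_iff)
  then obtain R R' where R: "R \<noteq> R'" "path_bundle x y {R, R'}" "B = bundle_graph {R, R'}"
    using cycle_bundle[OF assms(1)] by metis
  then show ?thesis using bundle_cycles_upper[OF R(2), of e] assms(2) by auto
qed

lemma theta_graph_cycles:
  assumes "theta_graph t B" "e \<in> edges B"
  shows "card (cycles_through B e) \<le> t - 1"
proof -
  obtain u v S where "path_bundle u v S" "card S = t" "B = bundle_graph S"
    using assms(1) unfolding theta_graph_iff_bundle by auto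
  then show ?thesis using bundle_cycles_upper assms(2) by fastforce
qed

lemma edge_graph_if_card_2:
  assumes "biconn B" "card (verts B) = 2"
  shows "edge_graph B"
proof -
  have sB: "simple_graph B" using assms(1) unfolding biconn_iff by simp
  obtain u v where uv: "verts B = {u, v}" "u \<noteq> v" using assms(2) by (auto simp: card_2_iff)
  have "e = {u, v}" if "e \<in> edges B" for e
    using sB that uv card_subset_eq[of "{u, v}" e] unfolding simple_graph_def by auto
  moreover obtain w where "{u, w} \<in> edges B"
    using vertex_has_edge[of u B] assms uv unfolding biconn_iff by auto
  ultimately have "edges B = {{u, v}}" by (intro equalityI subsetI) (metis singletonI, metis singletonD)
  then have "B = ({u, v}, {{u, v}})" using uv by (intro prod_eqI) auto
  then show ?thesis unfolding edge_graph_def using uv(2) by blast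
qed

text \<open>Each outcome of \<open>biconn_structure\<close> comes with an edge whose cycle count is
  compared with \<open>k\<close>: it bounds \<open>t\<close>, forces \<open>k = 4\<close>, or
  contradicts \<open>k\<close> being at most 4.\<close>

lemma biconn_few_cycles:
  assumes B: "biconn B" "card (verts B) \<ge> 2" and k: "\<forall>e\<in>edges B. card (cycles_through B e) \<le> k" "k \<le> 4"
  shows "edge_graph B \<or> cycle_graph B \<or> k = 4 \<and> theta3'_graph B \<or>
    (\<exists>t. 3 \<le> t \<and> t \<le> k + 1 \<and> theta_graph t B)"
proof (cases "card (verts B) = 2")
  case True
  then show ?thesis using edge_graph_if_card_2[OF B(1)] by simp
next
  case False
  then have "card (verts B) \<ge> 3" using B(2) by simp
  with B(1) show ?thesis
  proof (cases rule: biconn_structure)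
    case (theta t e)
    then have "t - 1 \<le> k" using k(1) order_trans by blast
    then show ?thesis using theta(1,2) by auto
  next
    case (theta3' e)
    then have "4 \<le> k" using k(1) order_trans by blast
    then show ?thesis using theta3'(1) k(2) by simp
  next
    case (many e)
    then have "5 \<le> k" using k(1) order_trans by blast
    then show ?thesis using k(2) by simp
  qed simp
qed

text \<open>One statement for all \<open>k\<close> from 1 to 4: the conjunct \<open>k = 4\<close>
  confines theta-prime graphs to the last case, and for \<open>k = 1\<close> the range of
  \<open>t\<close> is empty.\<close>

lemma few_cycles_iff:
  assumes B: "biconn B" "card (verts B) \<ge> 2" and k: "1 \<le> k" "k \<le> 4"
  shows "(\<forall>e\<in>edges B. card (cycles_through B e) \<le> k) \<longleftrightarrow>
    edge_graph B \<or> cycle_graph B \<or> k = 4 \<and> theta3'_graph B \<or>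
    (\<exists>t. 3 \<le> t \<and> t \<le> k + 1 \<and> theta_graph t B)" (is "?L \<longleftrightarrow> ?R")
proof
  assume ?R
  then consider "edge_graph B" | "cycle_graph B" | "k = 4" "theta3'_graph B"
    | t where "t \<le> k + 1" "theta_graph t B" by blast
  then show ?L
  proof cases
    case 1
    then have "cycles_through B e = {}" for e by (rule edge_graph_cycles)
    then show ?thesis by (simp only: card.empty) simp
  next
    case 2
    then show ?thesis using cycle_graph_cycles k(1) order_trans by blast
  next
    case 3
    then show ?thesis using theta3'_cycles_upper by blast
  next
    case (4 t)
    then have "t - 1 \<le> k" by simp
    then show ?thesis using theta_graph_cycles[OF 4(2)] order_trans by blast
  qed
qed (use biconn_few_cycles[OF B _ k(2)] in blast)

theorem theorem2:
  fixes G :: "'a ugraph"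
  assumes "connected_graph G" and "card (verts G) \<ge> 2"
  shows "(cactus 2 G \<longleftrightarrow>
            (\<forall>B. block B G \<longrightarrow> edge_graph B \<or> cycle_graph B \<or> theta_graph 3 B))
       \<and> (cactus 3 G \<longleftrightarrow>
            (\<forall>B. block B G \<longrightarrow> edge_graph B \<or> cycle_graph B \<or>
                 (\<exists>t. 3 \<le> t \<and> t \<le> 4 \<and> theta_graph t B)))
       \<and> (cactus 4 G \<longleftrightarrow>
            (\<forall>B. block B G \<longrightarrow> edge_graph B \<or> cycle_graph B \<or> theta3'_graph B \<or>
                 (\<exists>t. 3 \<le> t \<and> t \<le> 5 \<and> theta_graph t B)))"
proof -
  have *: "cactus k G \<longleftrightarrow> (\<forall>B. block B G \<longrightarrow>
      edge_graph B \<or> cycle_graph B \<or> k = 4 \<and> theta3'_graph B \<or>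
      (\<exists>t. 3 \<le> t \<and> t \<le> k + 1 \<and> theta_graph t B))" if k: "1 \<le> k" "k \<le> 4" for k
  proof -
    have "(\<forall>e\<in>edges B. card (cycles_through B e) \<le> k) \<longleftrightarrow>
        edge_graph B \<or> cycle_graph B \<or> k = 4 \<and> theta3'_graph B \<or>
        (\<exists>t. 3 \<le> t \<and> t \<le> k + 1 \<and> theta_graph t B)" if "block B G" for B
      using few_cycles_iff[OF _ block_card_verts[OF assms that] k] that unfolding block_iff by simp
    then show ?thesis unfolding cactus_iff_blocks[OF assms(1)] by blast
  qed
  \<comment> \<open>For \<open>k = 2\<close> the range of \<open>t\<close> shrinks to the single
    value 3.\<close>
  have "(\<exists>t. 3 \<le> t \<and> t \<le> 3 \<and> theta_graph t B) \<longleftrightarrow> theta_graph 3 B" for B :: "'a ugraph"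
    by (metis le_antisym order_refl)
  then show ?thesis using *[of 2] *[of 3] *[of 4] by simp
qed

end
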